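(* For every integer $n>0$, the roots of $H_n(x)$ are real and interlace those of $H_{n+1}(x)$.
   Context: For $k\ge 0$ let $a_k(x)=\sum_{m=0}^{k}\binom{3k+1-m}{k-m}x^m$, and for $n\ge 0$ let $H_n(x)=\det[a_{i+j}(x)]_{0\le i,j\le n}$ be the $(n+1)\times(n+1)$ Hankel determinant; $H_n(x)$ is a polynomial of degree $n$. Interlacing means: if $r_1<\dots<r_n$ are the roots of $H_n$ and $s_1<\dots<s_{n+1}$ are the roots of $H_{n+1}$, then $s_1<r_1<s_2<r_2<\cdots<r_n<s_{n+1}$. *)

theory Defs
  imports Complex_Main "Jordan_Normal_Form.Determinant"
begin

definition a_poly :: "nat \<Rightarrow> real poly" where
  "a_poly k = (\<Sum>m\<le>k. monom (of_nat ((3 * k + 1 - m) choose (k - m))) m)"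

definition H_poly :: "nat \<Rightarrow> real poly" where
  "H_poly n = det (mat (n + 1) (n + 1) (\<lambda>(i, j). a_poly (i + j)))"

definition all_roots_real :: "real poly \<Rightarrow> bool" where
  "all_roots_real p \<longleftrightarrow> (\<forall>z. poly (map_poly complex_of_real p) z = 0 \<longrightarrow> z \<in> \<real>)"

text \<open>
  The lists \<open>rs\<close> and \<open>ss\<close> are indexed from 0, so \<open>rs ! i\<close> is $r_{i+1}$. Roots are taken
  with multiplicity (\<^const>\<open>proots\<close>); as the lists are strictly increasing, all roots are
  simple.  The multiset \<^const>\<open>proots\<close> of the zero polynomial is empty by convention,
  which is why it is excluded.
\<close>
definition roots_interlace :: "nat \<Rightarrow> real poly \<Rightarrow> real poly \<Rightarrow> bool" where
  "roots_interlace n p q \<longleftrightarrow> p \<noteq> 0 \<and> q \<noteq> 0 \<and>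
     (\<exists>rs ss. length rs = n \<and> sorted_wrt (<) rs \<and> proots p = mset rs \<and>
        length ss = n + 1 \<and> sorted_wrt (<) ss \<and> proots q = mset ss \<and>
        (\<forall>i<n. ss ! i < rs ! i \<and> rs ! i < ss ! (i + 1)))"

end

theory Submission
  imports Defs "HOL-Computational_Algebra.Polynomial_FPS"
begin

hide_const (open) module.smult

text \<open>
  Up to a nonzero constant, \<open>H\<^sub>n(x)\<close> is the Jacobi polynomial
  \<open>A\<^sub>n(r) = 2F1(-n, 3n+3; 2n+5/2; r)\<close> at \<open>r = (x-1)/2\<close>
  (lemma \<open>H_poly_eq_A_poly\<close>), and the interlacing can be read off from contiguity relations.

  Interlacing. Together with \<open>B\<^sub>n(r) = 2F1(-n, 3n+1; 2n+3/2; r)\<close> the polynomials \<open>A\<^sub>n\<close> satisfy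
  first-order differential relations and three-term relations. At a root of \<open>A\<^sub>n\<close> in
  \<open>(1/4, 1)\<close> these say that \<open>A\<^sub>n\<^sub>+\<^sub>1\<close> is a positive multiple of \<open>A\<^sub>n'\<close>
  (lemma \<open>A_poly_Suc_at_root\<close>). Since \<open>A\<^sub>n\<close> is positive at \<open>1/4\<close> and has sign
  \<open>(-1)\<^sup>n\<close> at \<open>1\<close>, the intermediate value theorem gives, by induction on \<open>n\<close>, that \<open>A\<^sub>n\<close> has
  \<open>n\<close> simple roots in \<open>(1/4, 1)\<close> which separate those of \<open>A\<^sub>n\<^sub>+\<^sub>1\<close>.

  Identification of the determinant. Fix \<open>x\<close> and let \<open>p\<close> be the vector of cofactors of the last
  row of the Hankel matrix, so that \<open>p\<close> is orthogonal to the other rows, its product with the last row is \<open>H\<^sub>n(x)\<close>,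
  and its last entry is \<open>H\<^sub>n\<^sub>-\<^sub>1(x)\<close>. The \<open>a\<^sub>k(x)\<close> are the coefficients of
  \<open>1 / ((1-z) (1-3z) (1-xz))\<close> in powers of \<open>t = z (1-z)\<^sup>2\<close>. In terms of Pade approximation, \<open>p\<close> yields a polynomial
  \<open>N\<close> of degree at most \<open>n\<close> with \<open>N(0) = H\<^sub>n(x)\<close> and \<open>N(1) = H\<^sub>n\<^sub>-\<^sub>1(x)\<close>. The cubic
  \<open>t = z (1-z)\<^sup>2\<close> is uniformised by \<open>z = -(1-y)\<^sup>2 / (3y)\<close>, for which \<open>t = -(1-y\<^sup>3)\<^sup>2 / (27 y\<^sup>3)\<close>. In the
  variable \<open>y\<close>, and after multiplication by \<open>(2x-2) - (2x-3) z\<close> and elementary factors, \<open>N\<close> becomes a polynomial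
  without exponents congruent to 2 modulo 3 that vanishes to high order at \<open>y = 1\<close>. A nonzero polynomial with few terms
  cannot vanish to high order at \<open>1\<close>, so there is only a two-dimensional space of such polynomials
  (lemma \<open>exps_mod3_order_eq_0\<close>), independently of \<open>x\<close>. The ladder relations show that \<open>A\<^sub>n\<close> and \<open>A\<^sub>n\<^sub>-\<^sub>1\<close>
  provide a basis of it. Expressing \<open>[(2x-2) - (2x-3) z] N(z)\<close> in this basis and evaluating at the zero of the first factor gives
  \<open>c H\<^sub>n(x) A\<^sub>n\<^sub>-\<^sub>1(r) = H\<^sub>n\<^sub>-\<^sub>1(x) A\<^sub>n(r)\<close> with \<open>c \<noteq> 0\<close>, and induction finishes the proof.
\<close>

section \<open>Two families of hypergeometric polynomials\<close>

text \<open>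
  The \<open>j\<close>-th coefficient of the terminating series \<open>2F1(-n, b; c; r)\<close>. It vanishes for \<open>j > n\<close>
  because of the factor \<open>(-n)\<^sub>j\<close>, so no case distinction on \<open>j \<le> n\<close> is needed below.
\<close>
definition hyp_coeff :: "nat \<Rightarrow> real \<Rightarrow> real \<Rightarrow> nat \<Rightarrow> real" where
  "hyp_coeff n b c j = pochhammer (- real n) j * pochhammer b j / (pochhammer c j * fact j)"

text \<open>The polynomial \<open>2F1(-n, b; c; r)\<close> in the variable \<open>r\<close>.\<close>
definition hyp_poly :: "nat \<Rightarrow> real \<Rightarrow> real \<Rightarrow> real poly" where
  "hyp_poly n b c = (\<Sum>j\<le>n. monom (hyp_coeff n b c j) j)"

lemma hyp_coeff_eq_0: "n < j \<Longrightarrow> hyp_coeff n b c j = 0"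
  by (simp add: hyp_coeff_def pochhammer_of_nat_eq_0_lemma)

lemma coeff_hyp_poly: "coeff (hyp_poly n b c) j = hyp_coeff n b c j"
proof -
  have "coeff (hyp_poly n b c) j = (\<Sum>i\<le>n. if i = j then hyp_coeff n b c i else 0)"
    by (simp add: hyp_poly_def coeff_sum)
  also have "\<dots> = hyp_coeff n b c j"
    by (cases "j \<le> n") (auto simp: sum.delta' hyp_coeff_eq_0)
  finally show ?thesis .
qed

lemma degree_hyp_poly_le: "degree (hyp_poly n b c) \<le> n"
  by (rule degree_le) (simp add: coeff_hyp_poly hyp_coeff_eq_0)

lemma hyp_coeff_0 [simp]: "hyp_coeff n b c 0 = 1"
  by (simp add: hyp_coeff_def)

lemma hyp_coeff_Suc:
  assumes "c > 0"
  shows "hyp_coeff n b c (Suc j) =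
    hyp_coeff n b c j * ((real j - real n) * (b + real j) / ((c + real j) * (real j + 1)))"
  using assms by (simp add: hyp_coeff_def pochhammer_Suc field_simps)

text \<open>
  The polynomial \<open>A\<^sub>n(r) = 2F1(-n, 3n+3; 2n+5/2; r)\<close>, which up to a nonzero factor is \<open>H\<^sub>n(2r+1)\<close>.
  It is the Jacobi polynomial with parameters \<open>(1/2, 2n+3/2)\<close>, normalised to be \<open>1\<close> at the endpoint \<open>r = 0\<close>.
\<close>
definition A_poly :: "nat \<Rightarrow> real poly" where
  "A_poly n = hyp_poly n (3 * n + 3) (2 * n + 5 / 2)"

text \<open>
  The polynomial \<open>B\<^sub>n(r) = 2F1(-n, 3n+1; 2n+3/2; r)\<close>. In the ladder
  \<open>B\<^sub>0, A\<^sub>0, B\<^sub>1, A\<^sub>1, \<dots>\<close> each member is obtained from its neighbours by first-order differential relations and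
  by three-term relations, so that \<open>B\<^sub>n\<^sub>+\<^sub>1\<close> mediates between \<open>A\<^sub>n\<close> and \<open>A\<^sub>n\<^sub>+\<^sub>1\<close>.
\<close>
definition B_poly :: "nat \<Rightarrow> real poly" where
  "B_poly n = hyp_poly n (3 * n + 1) (2 * n + 3 / 2)"

abbreviation "A_coeff n \<equiv> coeff (A_poly n)"
abbreviation "B_coeff n \<equiv> coeff (B_poly n)"

lemma A_coeff_0 [simp]: "A_coeff n 0 = 1" and B_coeff_0 [simp]: "B_coeff n 0 = 1"
  by (simp_all add: A_poly_def B_poly_def coeff_hyp_poly)

lemma A_coeff_Suc: "A_coeff n (Suc j) = A_coeff n j *
    ((real j - n) * (3 * n + 3 + j) / ((2 * n + 5 / 2 + j) * (real j + 1)))"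
  by (simp add: A_poly_def coeff_hyp_poly hyp_coeff_Suc)

lemma B_coeff_Suc: "B_coeff n (Suc j) = B_coeff n j *
    ((real j - n) * (3 * n + 1 + j) / ((2 * n + 3 / 2 + j) * (real j + 1)))"
  by (simp add: B_poly_def coeff_hyp_poly hyp_coeff_Suc)

lemma A_coeff_eq_B_coeff_Suc:
  "A_coeff n j = B_coeff (Suc n) j *
     (3 * (real n + 1 - j) * (4 * n + 5 + 2 * j) / ((3 * n + 3 + j) * (4 * real n + 5)))"
proof (induction j)
  case (Suc j)
  show ?case unfolding A_coeff_Suc B_coeff_Suc Suc.IH
    apply (simp add: divide_simps add_nonneg_eq_0_iff)
    apply (auto simp: algebra_simps)
    done
qed (simp_all add: divide_simps)

lemma B_coeff_eq_A_coeff: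
  "B_coeff n j = A_coeff n j *
     ((3 * real n + 1) * (3 * n + 2) * (4 * n + 3 + 2 * j) /
      ((3 * n + 1 + j) * (3 * n + 2 + j) * (4 * real n + 3)))"
proof (induction j)
  case (Suc j)
  show ?case unfolding A_coeff_Suc B_coeff_Suc Suc.IH
    apply (simp add: divide_simps add_nonneg_eq_0_iff)
    apply (auto simp: algebra_simps)
    done
qed (simp_all add: divide_simps)

text \<open>
  The next four identities are compared coefficientwise: all coefficients involved are multiples
  of a single one, with factors rational in \<open>n\<close> and \<open>j\<close>, and what remains is an identity between rational functions of \<open>n\<close> and \<open>j\<close>.
\<close>
lemma B_poly_deriv_rel:
  "[:4 * real n + 5, 8 * real n + 8:] * B_poly (Suc n) + [:0, 2, -8:] * pderiv (B_poly (Suc n))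
    = smult (4 * real n + 5) (A_poly n)"
proof (rule poly_eqI)
  fix j
  show "coeff ([:4 * real n + 5, 8 * real n + 8:] * B_poly (Suc n) + [:0, 2, -8:] * pderiv (B_poly (Suc n))) j
    = coeff (smult (4 * real n + 5) (A_poly n)) j"
  proof (cases j)
    case (Suc i)
    have "coeff ([:4 * real n + 5, 8 * real n + 8:] * B_poly (Suc n) + [:0, 2, -8:] * pderiv (B_poly (Suc n))) j
      = (4 * real n + 5 + 2 * (real i + 1)) * B_coeff (Suc n) (Suc i)
        + 8 * (real n + 1 - i) * B_coeff (Suc n) i"
      by (cases i) (simp_all add: Suc coeff_pderiv algebra_simps)
    also have "\<dots> = (4 * real n + 5) * A_coeff n (Suc i)"
      unfolding A_coeff_eq_B_coeff_Suc B_coeff_Suc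
      by (simp add: divide_simps add_nonneg_eq_0_iff) (auto simp: algebra_simps)
    finally show ?thesis using Suc by simp
  qed simp
qed

lemma A_poly_deriv_rel:
  "[:0, 3:] * A_poly n + [:1, -1:] * ([:4 * real n + 3, 8 * real n:] * A_poly n + [:0, 2, -8:] * pderiv (A_poly n))
    = smult (4 * real n + 3) (B_poly n)" (is "?L = ?R")
proof (rule poly_eqI)
  fix j
  show "coeff ?L j = coeff ?R j"
  proof (cases j)
    case 0
    then show ?thesis by simp
  next
    case j: (Suc i)
    show ?thesis
    proof (cases i)
      case 0
      show ?thesis using A_coeff_Suc[of n 0] B_coeff_Suc[of n 0]
        by (simp add: j 0 coeff_pderiv divide_simps) (auto simp: algebra_simps)
    next
      case (Suc k)
      have "coeff ?L j = (4 * real n + 3 + 2 * (real k + 2)) * A_coeff n (Suc (Suc k))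
        + (3 + 8 * (real n - k - 1) - (4 * n + 3 + 2 * (real k + 1))) * A_coeff n (Suc k)
        - 8 * (real n - k) * A_coeff n k"
        by (cases k) (simp_all add: j Suc coeff_pderiv algebra_simps)
      also have "\<dots> = (4 * real n + 3) * B_coeff n (Suc (Suc k))"
        unfolding B_coeff_eq_A_coeff A_coeff_Suc
        by (simp add: divide_simps add_nonneg_eq_0_iff) (auto simp: algebra_simps)
      finally show ?thesis using Suc j by simp
    qed
  qed
qed

lemma A_poly_three_term:
  "smult (12 * (3 * real n + 4) * (3 * n + 5)) ([:0, 1:] * A_poly (Suc n)) =
   smult ((4 * real n + 5) * (4 * n + 7)) ([:1, 8:] * B_poly (Suc n) - A_poly n)" (is "?L = ?R")
proof (rule poly_eqI)
  fix j
  show "coeff ?L j = coeff ?R j"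
  proof (cases j)
    case 0
    then show ?thesis by simp
  next
    case (Suc i)
    have 1: "A_coeff (Suc n) i = B_coeff (Suc n) i * 
      ((3 * n + 4 + i) * (3 * n + 5 + i) * (4 * real n + 7) /
       ((3 * real n + 4) * (3 * n + 5) * (4 * n + 7 + 2 * i)))"
      using B_coeff_eq_A_coeff[of "Suc n" i]
      by (simp add: divide_simps add_nonneg_eq_0_iff) (auto simp: algebra_simps)
    show ?thesis unfolding Suc
      apply (simp add: 1)
      unfolding A_coeff_eq_B_coeff_Suc B_coeff_Suc
      by (simp add: divide_simps add_nonneg_eq_0_iff) (auto simp: algebra_simps)
  qed
qed

lemma B_poly_three_term:
  "smult (3 * (6 * real n + 5) * (6 * n + 7)) ([:0, 1:] * B_poly (Suc n)) =
   smult ((4 * real n + 3) * (4 * n + 5)) ([:1, 7, -8:] * A_poly n - B_poly n)" (is "?L = ?R")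
proof (rule poly_eqI)
  fix j
  show "coeff ?L j = coeff ?R j"
  proof (cases j)
    case 0
    then show ?thesis by simp
  next
    case j: (Suc i)
    show ?thesis
    proof (cases i)
      case 0
      have "A_coeff n (Suc 0) = - real n * (3 * n + 3) / (2 * n + 5 / 2)"
        "B_coeff n (Suc 0) = - real n * (3 * n + 1) / (2 * n + 3 / 2)"
        using A_coeff_Suc[of n 0] B_coeff_Suc[of n 0] by simp_all
      then have "coeff ?R j = (4 * real n + 3) * (4 * n + 5) *
          (7 - real n * (3 * n + 3) / (2 * n + 5 / 2) + real n * (3 * n + 1) / (2 * n + 3 / 2))"
        by (simp add: j 0)
      also have "\<dots> = 3 * (6 * real n + 5) * (6 * n + 7)"
        by (simp add: divide_simps add_nonneg_eq_0_iff) (auto simp: algebra_simps)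
      finally show ?thesis by (simp add: j 0)
    next
      case (Suc k)
      have "coeff ?R j = (4 * real n + 3) * (4 * n + 5) *
         (A_coeff n (Suc (Suc k)) + 7 * A_coeff n (Suc k) - 8 * A_coeff n k - B_coeff n (Suc (Suc k)))"
        by (simp add: j Suc)
      also have "\<dots> = 3 * (6 * real n + 5) * (6 * n + 7) * B_coeff (Suc n) (Suc k)"
        unfolding B_coeff_eq_A_coeff[of n] A_coeff_Suc
        unfolding A_coeff_eq_B_coeff_Suc B_coeff_Suc
        by (simp add: divide_simps add_nonneg_eq_0_iff) (auto simp: algebra_simps)
      finally show ?thesis using Suc j by simp
    qed
  qed
qed

text \<open>
  Signs at the endpoints of \<open>(1/4, 1)\<close>: at \<open>r = 1/4\<close> the derivative terms of the ladder relations vanish,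
  and at \<open>r = 1\<close> the factor \<open>1 - r\<close> kills most terms.
\<close>
lemma A_poly_quarter_pos: "poly (A_poly n) (1/4) > 0"
  and B_poly_quarter_pos: "poly (B_poly n) (1/4) > 0"
proof (induction n)
  case 0
  show "poly (A_poly 0) (1/4) > 0" "poly (B_poly 0) (1/4) > 0"
    by (simp_all add: A_poly_def B_poly_def hyp_poly_def hyp_coeff_def poly_monom)
next
  case (Suc n)
  show B: "poly (B_poly (Suc n)) (1/4) > 0"
  proof -
    have "(6 * real n + 7) * poly (B_poly (Suc n)) (1/4) = (4 * real n + 5) * poly (A_poly n) (1/4)"
      using arg_cong[OF B_poly_deriv_rel[of n], of "\<lambda>p. poly p (1/4)"]
      by (simp add: algebra_simps)
    then show ?thesis using Suc.IH(1)
      by (smt (verit, best) mult_pos_pos of_nat_0_le_iff zero_less_mult_pos)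
  qed
  show "poly (A_poly (Suc n)) (1/4) > 0"
  proof -
    have "(18 * real n + 30) / 4 * poly (A_poly (Suc n)) (1/4) = (4 * real n + 7) * poly (B_poly (Suc n)) (1/4)"
      using arg_cong[OF A_poly_deriv_rel[of "Suc n"], of "\<lambda>p. poly p (1/4)"]
      by (simp add: field_simps)
    also have "\<dots> > 0"
      using B by (intro mult_pos_pos) auto
    finally show ?thesis by (simp add: zero_less_mult_iff)
  qed
qed

lemma A_poly_1: "3 * poly (A_poly n) 1 = (4 * real n + 3) * poly (B_poly n) 1"
  using arg_cong[OF A_poly_deriv_rel[of n], of "\<lambda>p. poly p 1"] by simp

lemma B_poly_1_sign: "(-1) ^ n * poly (B_poly n) 1 > 0"
proof (induction n)
  case 0
  then show ?case by (simp add: B_poly_def hyp_poly_def hyp_coeff_def poly_monom)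
next
  case (Suc n)
  define K L where "K = 3 * (6 * real n + 5) * (6 * n + 7)"
    and "L = (4 * real n + 3) * (4 * n + 5)"
  have KL: "K > 0" "L > 0"
    by (auto simp: K_def L_def intro!: mult_pos_pos)
  have "K * poly (B_poly (Suc n)) 1 = - L * poly (B_poly n) 1"
    using arg_cong[OF B_poly_three_term[of n], of "\<lambda>p. poly p 1"] by (simp add: K_def L_def)
  then have "K * ((-1) ^ Suc n * poly (B_poly (Suc n)) 1) = L * ((-1) ^ n * poly (B_poly n) 1)"
    by (simp only: power_Suc) (metis mult.left_commute mult_minus1 minus_mult_minus mult_minus_left)
  also have "\<dots> > 0"
    using KL(2) Suc by (rule mult_pos_pos)
  finally show ?case using KL by (metis zero_less_mult_pos)
qed

lemma A_poly_1_sign: "(-1) ^ n * poly (A_poly n) 1 > 0"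
proof -
  have "3 * ((-1) ^ n * poly (A_poly n) 1) = (4 * real n + 3) * ((-1) ^ n * poly (B_poly n) 1)"
    using A_poly_1[of n] by (metis mult.left_commute)
  also have "\<dots> > 0"
    by (rule mult_pos_pos) (use B_poly_1_sign[of n] in auto)
  finally show ?thesis by (simp add: mult.commute)
qed

lemma A_coeff_top_sign: "(-1) ^ n * A_coeff n n > 0"
proof -
  have "pochhammer (- real n) n = (-1) ^ n * fact n"
    using pochhammer_same[of n, where 'a = real] by simp
  then have "(-1) ^ n * A_coeff n n = pochhammer (3 * real n + 3) n / pochhammer (2 * n + 5 / 2) n"
    by (simp add: A_poly_def coeff_hyp_poly hyp_coeff_def flip: mult.assoc power_mult_distrib)
  also have "\<dots> > 0"
    by (intro divide_pos_pos pochhammer_pos) auto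
  finally show ?thesis .
qed

lemma degree_A_poly: "degree (A_poly n) = n"
proof (rule antisym)
  show "degree (A_poly n) \<le> n" by (simp add: A_poly_def degree_hyp_poly_le)
  show "n \<le> degree (A_poly n)" using A_coeff_top_sign[of n] by (intro le_degree) auto
qed

lemma degree_B_poly_le: "degree (B_poly n) \<le> n"
  by (simp add: B_poly_def degree_hyp_poly_le)

text \<open>
  At a root of \<open>A\<^sub>n\<close> in \<open>(1/4, 1)\<close> the relations reduce to single terms: \<open>A\<^sub>n\<^sub>+\<^sub>1\<close> is a positive multiple
  of \<open>B\<^sub>n\<^sub>+\<^sub>1\<close>, which is a negative multiple of \<open>B\<^sub>n\<close>, which is a negative multiple of \<open>A\<^sub>n'\<close>.
\<close>
lemma A_poly_Suc_at_root:
  assumes root: "poly (A_poly n) r = 0" and r: "1/4 < r" "r < 1"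
  obtains c where "c > 0" "poly (A_poly (Suc n)) r = c * poly (pderiv (A_poly n)) r"
proof -
  define P Q R where "P = 12 * (3 * real n + 4) * (3 * n + 5) * r"
    and "Q = 3 * (6 * real n + 5) * (6 * n + 7) * r" and "R = 2 * r * (4 * r - 1) * (1 - r)"
  have pos: "P > 0" "Q > 0" "R > 0"
    using r by (auto simp: P_def Q_def R_def intro!: mult_pos_pos)
  have 1: "P * poly (A_poly (Suc n)) r = ((4 * real n + 5) * (4 * n + 7) * (1 + 8 * r)) * poly (B_poly (Suc n)) r"
    using arg_cong[OF A_poly_three_term[of n], of "\<lambda>p. poly p r"] root by (simp add: P_def algebra_simps)
  have 2: "Q * poly (B_poly (Suc n)) r = - ((4 * real n + 3) * (4 * n + 5)) * poly (B_poly n) r"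
    using arg_cong[OF B_poly_three_term[of n], of "\<lambda>p. poly p r"] root by (simp add: Q_def algebra_simps)
  have 3: "- R * poly (pderiv (A_poly n)) r = (4 * real n + 3) * poly (B_poly n) r"
    using arg_cong[OF A_poly_deriv_rel[of n], of "\<lambda>p. poly p r"] root by (simp add: R_def algebra_simps)
  have "poly (A_poly (Suc n)) r =
    ((4 * real n + 5) * (4 * n + 7) * (1 + 8 * r)) / P * poly (B_poly (Suc n)) r"
    using 1 pos by (simp add: field_simps)
  also have "poly (B_poly (Suc n)) r = - ((4 * n + 5) * ((4 * real n + 3) * poly (B_poly n) r) / Q)"
    using 2 pos by (simp add: field_simps)
  also have "(4 * real n + 3) * poly (B_poly n) r = - R * poly (pderiv (A_poly n)) r"
    using 3 by simp
  finally have "poly (A_poly (Suc n)) r = (((4 * real n + 5) * (4 * n + 7) * (1 + 8 * r)) / P * ((4 * n + 5) * R / Q))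
     * poly (pderiv (A_poly n)) r"
    by (simp only: divide_inverse) (simp add: mult_ac)
  moreover have "((4 * real n + 5) * (4 * n + 7) * (1 + 8 * r)) / P * ((4 * n + 5) * R / Q) > 0"
    using pos r by (intro mult_pos_pos divide_pos_pos) auto
  ultimately show ?thesis using that by blast
qed

section \<open>Roots of the polynomials and their interlacing\<close>

lemma poly_eq_prod_roots:
  fixes p :: "real poly" and r :: "nat \<Rightarrow> real"
  assumes "degree p = n" and "\<And>i. i < n \<Longrightarrow> poly p (r i) = 0" and "inj_on r {..<n}"
  shows "p = smult (lead_coeff p) (\<Prod>i<n. [:- r i, 1:])"
proof (cases "n = 0")
  case True
  then show ?thesis using assms(1) by (auto elim!: degree_eq_zeroE)
next
  case False
  let ?q = "smult (lead_coeff p) (\<Prod>i<n. [:- r i, 1:])"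
  have p0: "p \<noteq> 0" using False assms(1) by auto
  have deg: "degree (\<Prod>i<n. [:- r i, 1:]) = n"
    by (subst degree_prod_eq_sum_degree) auto
  have mon: "lead_coeff (\<Prod>i<n. [:- r i, 1:]) = 1"
    by (simp add: lead_coeff_prod)
  show ?thesis
  proof (rule poly_eqI_degree_lead_coeff[where n = n and A = "r ` {..<n}"])
    show "card (r ` {..<n}) \<ge> n" using assms(3) by (simp add: card_image)
    show "poly p z = poly ?q z" if "z \<in> r ` {..<n}" for z
      using that assms(2) by (auto simp: poly_prod)
    show "coeff p n = coeff ?q n" using assms(1) deg mon by simp
  qed (use assms(1) deg in auto)
qed

text \<open>
  The derivative at the root \<open>r\<^sub>i\<close> is the leading coefficient times the product of all \<open>r\<^sub>i - r\<^sub>j\<close>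
  with \<open>j \<noteq> i\<close>, of which exactly \<open>n - 1 - i\<close> are negative.
\<close>
lemma sgn_pderiv_at_root:
  fixes p :: "real poly" and r :: "nat \<Rightarrow> real"
  assumes "degree p = n" and "\<And>i. i < n \<Longrightarrow> poly p (r i) = 0"
    and mono: "\<And>i j. i < j \<Longrightarrow> j < n \<Longrightarrow> r i < r j" and i: "i < n"
  shows "(-1) ^ (n - 1 - i) * (poly (pderiv p) (r i) / lead_coeff p) > 0"
proof -
  have inj: "inj_on r {..<n}"
    using mono by (intro linorder_inj_onI) (auto, fastforce)
  have n: "n > 0" using i by simp
  have lc: "lead_coeff p \<noteq> 0" using n assms(1) by auto
  have "pderiv p = smult (lead_coeff p) (pderiv (\<Prod>i<n. [:- r i, 1:]))"
    using arg_cong[OF poly_eq_prod_roots[OF assms(1,2) inj], of pderiv] by (simp add: pderiv_smult)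
  also have "pderiv (\<Prod>i<n. [:- r i, 1:]) = (\<Sum>k<n. \<Prod>j\<in>{..<n} - {k}. [:- r j, 1:])"
    by (subst pderiv_prod) (simp add: pderiv_pCons)
  finally have "poly (pderiv p) (r i) / lead_coeff p = (\<Sum>k<n. \<Prod>j\<in>{..<n} - {k}. r i - r j)"
    using lc by (simp add: poly_sum poly_prod)
  also have "\<dots> = (\<Sum>k<n. if k = i then \<Prod>j\<in>{..<n} - {i}. r i - r j else 0)"
    using i by (intro sum.cong refl) (auto simp: prod_zero_iff)
  also have "\<dots> = (\<Prod>j\<in>{..<n} - {i}. r i - r j)"
    using i by simp
  also have "{..<n} - {i} = {..<i} \<union> {Suc i..<n}" using i by auto
  also have "(\<Prod>j\<in>{..<i} \<union> {Suc i..<n}. r i - r j) =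
      (\<Prod>j<i. r i - r j) * (\<Prod>j\<in>{Suc i..<n}. r i - r j)"
    by (rule prod.union_disjoint) auto
  also have "(\<Prod>j\<in>{Suc i..<n}. r i - r j) = (\<Prod>j\<in>{Suc i..<n}. (-1) * (r j - r i))"
    by simp
  also have "\<dots> = (-1) ^ (n - 1 - i) * (\<Prod>j\<in>{Suc i..<n}. r j - r i)"
    unfolding prod.distrib by simp
  finally have "(-1) ^ (n - 1 - i) * (poly (pderiv p) (r i) / lead_coeff p) =
     (\<Prod>j<i. r i - r j) * (\<Prod>j\<in>{Suc i..<n}. r j - r i)"
    by (simp flip: mult.assoc power_mult_distrib) 
  also have "\<dots> > 0"
    using mono i by (intro mult_pos_pos prod_pos) auto
  finally show ?thesis .
qed

text \<open>
  The values \<open>r 0 < \<dots> < r (n - 1)\<close> are roots of \<open>p\<close> in the open interval \<open>(1/4, 1)\<close>. For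
  \<open>p = A\<^sub>n\<close> these are all roots, by degree.
\<close>
definition increasing_roots :: "real poly \<Rightarrow> nat \<Rightarrow> (nat \<Rightarrow> real) \<Rightarrow> bool" where
  "increasing_roots p n r \<longleftrightarrow> (\<forall>i<n. 1/4 < r i \<and> r i < 1 \<and> poly p (r i) = 0) \<and>
     (\<forall>i j. i < j \<longrightarrow> j < n \<longrightarrow> r i < r j)"

text \<open>
  The points \<open>1/4 < r\<^sub>0 < \<dots> < r\<^sub>n\<^sub>-\<^sub>1 < 1\<close> cut \<open>(1/4, 1)\<close> into \<open>n + 1\<close> intervals, and \<open>A\<^sub>n\<^sub>+\<^sub>1\<close> has opposite
  signs at the ends of each of them.
\<close>
lemma A_poly_Suc_roots:
  assumes "increasing_roots (A_poly n) n r"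
  obtains s where "increasing_roots (A_poly (Suc n)) (Suc n) s" "\<And>i. i < n \<Longrightarrow> s i < r i \<and> r i < s (Suc i)"
proof -
  let ?p = "A_poly (Suc n)"
  have r: "1/4 < r i" "r i < 1" "poly (A_poly n) (r i) = 0" if "i < n" for i
    using assms that by (auto simp: increasing_roots_def)
  have mono: "r i < r j" if "i < j" "j < n" for i j
    using assms that by (auto simp: increasing_roots_def)
  \<comment> \<open>the cut points: \<open>1/4\<close>, then the roots of \<open>A\<^sub>n\<close>, then \<open>1\<close>\<close>
  define e where "e i = (if i = 0 then 1/4 else if i \<le> n then r (i - 1) else 1)" for i
  have e: "e i < e (Suc i)" if "i \<le> n" for i
    using that r mono by (auto simp: e_def)
  have sgn: "(-1) ^ i * poly ?p (e i) > 0" if i: "i \<le> Suc n" for i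
  proof -
    consider "i = 0" | "i = Suc n" | k where "i = Suc k" "k < n"
    proof (cases i)
      case (Suc k)
      then have "k = n \<or> k < n" using i by auto
      then show ?thesis using Suc that(2,3) by blast
    qed blast
    then show ?thesis
    proof cases
      case 1
      then show ?thesis by (simp add: e_def A_poly_quarter_pos)
    next
      case 2
      then show ?thesis using A_poly_1_sign[of "Suc n"] by (simp add: e_def)
    next
      case 3
      obtain c where c: "c > 0" "poly ?p (r k) = c * poly (pderiv (A_poly n)) (r k)"
        using A_poly_Suc_at_root r 3 by blast
      have "0 < (-1) ^ (n - 1 - k) * (poly (pderiv (A_poly n)) (r k) / lead_coeff (A_poly n))"
        by (rule sgn_pderiv_at_root) (use r mono 3 degree_A_poly in auto)
      also have "lead_coeff (A_poly n) = A_coeff n n" by (simp add: degree_A_poly)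
      finally have "0 < (-1) ^ (n - 1 - k) * (poly (pderiv (A_poly n)) (r k) / A_coeff n n) *
          ((-1) ^ n * A_coeff n n)"
        using A_coeff_top_sign by (rule mult_pos_pos)
      also have "\<dots> = (-1) ^ (n - 1 - k) * (-1) ^ n * poly (pderiv (A_poly n)) (r k)"
        using A_coeff_top_sign[of n] by auto
      also have "(-1) ^ (n - 1 - k) * (-1) ^ n = ((-1) ^ Suc k :: real)"
        using 3(2) by (auto simp: uminus_power_if split: if_splits)
      finally have "0 < c * ((-1) ^ Suc k * poly (pderiv (A_poly n)) (r k))"
        using c(1) by (intro mult_pos_pos[of c])
      then show ?thesis using 3 c by (simp add: e_def algebra_simps)
    qed
  qed
  have "\<exists>x. e i < x \<and> x < e (Suc i) \<and> poly ?p x = 0" if "i \<le> n" for i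
  proof -
    have "0 < ((-1) ^ i * poly ?p (e i)) * ((-1) ^ Suc i * poly ?p (e (Suc i)))"
      using mult_pos_pos[OF sgn[of i] sgn[of "Suc i"]] that by simp
    then have "poly ?p (e i) * poly ?p (e (Suc i)) < 0"
      by (simp add: algebra_simps mult_less_0_iff zero_less_mult_iff uminus_power_if split: if_splits)
    then show ?thesis using poly_IVT[OF e[OF that]] by blast
  qed
  then obtain s where s: "e i < s i" "s i < e (Suc i)" "poly ?p (s i) = 0" if "i \<le> n" for i
    by metis
  have e_mono: "e i \<le> e j" if "i \<le> j" "j \<le> Suc n" for i j
    using that(1,2) by (induction rule: dec_induct) (use e less_eq_Suc_le in \<open>force+\<close>)
  have "increasing_roots ?p (Suc n) s"
    unfolding increasing_roots_def
  proof (intro conjI allI impI)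
    fix i assume "i < Suc n"
    then show "1/4 < s i" "s i < 1" "poly ?p (s i) = 0"
      using s[of i] e_mono[of 0 i] e_mono[of "Suc i" "Suc n"] by (auto simp: e_def)
  next
    fix i j assume "i < j" "j < Suc n"
    then show "s i < s j" using s[of i] s[of j] e_mono[of "Suc i" j] by auto
  qed
  moreover have "s i < r i \<and> r i < s (Suc i)" if "i < n" for i
    using s[of i] s[of "Suc i"] that by (auto simp: e_def)
  ultimately show ?thesis using that by blast
qed

lemma A_poly_roots: "\<exists>r. increasing_roots (A_poly n) n r"
proof (induction n)
  case 0
  then show ?case by (simp add: increasing_roots_def)
next
  case (Suc n)
  then show ?case using A_poly_Suc_roots by metis
qed

text \<open>As many distinct real roots as the degree permits leave no room for multiple or complex ones.\<close>
lemma proots_eq_of_degree_le_length: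
  fixes p :: "real poly"
  assumes p: "p \<noteq> 0" "degree p \<le> length rs" and rs: "distinct rs" "\<And>r. r \<in> set rs \<Longrightarrow> poly p r = 0"
  shows "proots p = mset rs" "all_roots_real p"
proof -
  have "set rs \<subseteq> set_mset (proots p)" using p rs by auto
  then have "mset_set (set rs) \<subseteq># proots p"
    by (metis finite_set_mset mset_set_set_mset_msubset subset_imp_msubset_mset_set
        subset_mset.order_trans)
  then have sub: "mset rs \<subseteq># proots p" using rs(1) by (simp add: mset_set_set)
  have "size (proots p) \<le> size (mset rs)"
    using size_proots_le[of p] p(2) by simp
  then show "proots p = mset rs"
    using sub by (metis size_mset_mono subset_mset.antisym_conv2 mset_subset_size not_less)
  define q where "q = map_poly complex_of_real p"
  have q: "q \<noteq> 0" "degree q = degree p"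
    using p(1) by (auto simp: q_def map_poly_eq_0_iff intro!: degree_map_poly)
  have "complex_of_real ` set rs \<subseteq> {z. poly q z = 0}"
  proof -
    have "poly q (of_real x) = of_real (poly p x)" for x
      unfolding q_def by (induction p) (auto simp: map_poly_pCons)
    then show ?thesis using rs(2) by auto
  qed
  moreover have "card {z. poly q z = 0} \<le> card (complex_of_real ` set rs)"
    using card_poly_roots_bound[OF q(1)] p(2) q(2) rs(1)
    by (simp add: card_image inj_on_def distinct_card)
  ultimately have "{z. poly q z = 0} = complex_of_real ` set rs"
    using card_seteq[OF poly_roots_finite[OF q(1)]] by metis
  then show "all_roots_real p"
    unfolding all_roots_real_def q_def[symmetric] by (metis (mono_tags) Reals_of_real imageE mem_Collect_eq)
qed

text \<open>The substitution \<open>r = (x - 1) / 2\<close> carries a root \<open>r\<close> to \<open>x = 2r + 1\<close>.\<close>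
lemma increasing_roots_rescaled:
  fixes p :: "real poly"
  assumes p: "increasing_roots p n r" "degree p = n" "p \<noteq> 0" and c: "c \<noteq> 0"
    and q: "q = smult c (p \<circ>\<^sub>p [:-1/2, 1/2:])"
  defines "rs \<equiv> map (\<lambda>i. 2 * r i + 1) [0..<n]"
  shows "q \<noteq> 0" "sorted_wrt (<) rs" "proots q = mset rs" "all_roots_real q"
proof -
  show sorted: "sorted_wrt (<) rs"
    using p(1) by (auto simp: rs_def sorted_wrt_iff_nth_less increasing_roots_def)
  have "p \<circ>\<^sub>p [:-1/2, 1/2:] \<noteq> 0"
    using p(3) by (simp add: pcompose_eq_0_iff)
  then show q0: "q \<noteq> 0" using c q by simp
  have "degree q \<le> length rs" using p(2) by (simp add: q rs_def degree_pcompose)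
  moreover have "poly q x = 0" if x: "x \<in> set rs" for x
  proof -
    obtain i where "i < n" "x = 2 * r i + 1" using x by (auto simp: rs_def)
    moreover have "(2 * r i + 1) / 2 - 1 / 2 = r i" by (simp add: field_simps)
    ultimately show ?thesis using p(1) by (simp add: q poly_pcompose increasing_roots_def)
  qed
  ultimately show "proots q = mset rs" "all_roots_real q"
    using proots_eq_of_degree_le_length[OF q0] strict_sorted_iff[of rs] sorted by blast+
qed

section \<open>Sparse polynomials with a zero of high order\<close>

text \<open>All exponents that occur in \<open>p\<close> have a residue modulo 3 in \<open>S\<close>.\<close>
definition exps_mod3_in :: "nat set \<Rightarrow> 'a::zero poly \<Rightarrow> bool" where
  "exps_mod3_in S p \<longleftrightarrow> (\<forall>j. j mod 3 \<notin> S \<longrightarrow> coeff p j = 0)"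

text \<open>Multiplication by a polynomial in \<open>y\<^sup>3\<close> does not change the residues that occur.\<close>
lemma exps_mod3_in_mult:
  assumes "exps_mod3_in {0} q" "exps_mod3_in S (p :: real poly)"
  shows "exps_mod3_in S (q * p)"
  unfolding exps_mod3_in_def
proof (intro allI impI)
  fix j assume j: "j mod 3 \<notin> S"
  have "coeff q i * coeff p (j - i) = 0" if "i \<le> j" for i
  proof (cases "i mod 3 = 0")
    case True
    then have "(j - i) mod 3 = j mod 3"
      using that by (metis add_diff_cancel_right' le_iff_add mod_add_eq add_0 mod_mod_trivial add_diff_inverse_nat not_less)
    then show ?thesis using assms(2) j by (simp add: exps_mod3_in_def)
  qed (use assms(1) in \<open>simp add: exps_mod3_in_def\<close>)
  then show "coeff (q * p) j = 0" unfolding coeff_mult by (intro sum.neutral) auto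
qed

lemma exps_mod3_in_1: "exps_mod3_in {0} (1 :: real poly)"
  by (auto simp: exps_mod3_in_def intro!: gr0I)

lemma exps_mod3_in_power: "exps_mod3_in {0} q \<Longrightarrow> exps_mod3_in {0} ((q :: real poly) ^ n)"
  by (induction n) (auto simp: exps_mod3_in_1 intro: exps_mod3_in_mult)

lemma exps_mod3_in_smult: "exps_mod3_in S p \<Longrightarrow> exps_mod3_in S (smult (c::real) p)"
  and exps_mod3_in_diff: "exps_mod3_in S p \<Longrightarrow> exps_mod3_in S q \<Longrightarrow> exps_mod3_in S (p - q :: real poly)"
  and exps_mod3_in_add: "exps_mod3_in S p \<Longrightarrow> exps_mod3_in S q \<Longrightarrow> exps_mod3_in S (p + q :: real poly)"
  by (auto simp: exps_mod3_in_def)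

lemma exps_mod3_in_sum:
  "(\<And>i. i \<in> I \<Longrightarrow> exps_mod3_in S (f i)) \<Longrightarrow> exps_mod3_in S (\<Sum>i\<in>I. f i :: real poly)"
  by (auto simp: exps_mod3_in_def coeff_sum intro!: sum.neutral)

lemma exps_mod3_in_cubic: "exps_mod3_in {0} [:a, 0, 0, b::real:]"
  and exps_mod3_in_quartic: "exps_mod3_in {0, 1} [:a, b, 0, c, d::real:]"
  by (auto simp: exps_mod3_in_def coeff_pCons split: nat.splits)

text \<open>
  A nonzero polynomial with at most \<open>N\<close> terms vanishes at \<open>1\<close> to an order less than \<open>N\<close>: the
  operator \<open>y d/dy - m\<close> removes the term with exponent \<open>m\<close> and lowers the order by at most one.
\<close>
lemma sparse_poly_order_eq_0:
  fixes p :: "real poly"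
  assumes "[:1, -1:] ^ N dvd p" and "card {j. coeff p j \<noteq> 0} \<le> N"
  shows "p = 0"
  using assms
proof (induction N arbitrary: p)
  case 0
  have "finite {j. coeff p j \<noteq> 0}"
    by (rule finite_subset[of _ "{..degree p}"]) (auto intro: le_degree)
  then show ?case using 0 by (auto intro: poly_eqI)
next
  case (Suc N)
  show ?case
  proof (rule ccontr)
    assume "p \<noteq> 0"
    define m where "m = degree p"
    have m: "coeff p m \<noteq> 0" using \<open>p \<noteq> 0\<close> by (simp add: m_def)
    define q where "q = [:0, 1:] * pderiv p - smult (real m) p"
    have coeff_q: "coeff q j = (real j - m) * coeff p j" for j
      by (cases j) (simp_all add: q_def coeff_pderiv algebra_simps)
    obtain k where k: "p = [:1, -1:] ^ Suc N * k" using Suc.prems(1) by auto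
    have "pderiv p = [:1, -1:] ^ N * (- smult (real (Suc N)) k + [:1, -1:] * pderiv k)"
      unfolding k pderiv_mult pderiv_power_Suc
      by (simp add: pderiv_pCons algebra_simps)
    moreover have "[:1, -1:] ^ N dvd p"
      unfolding k by (intro dvd_mult2 le_imp_power_dvd) simp
    ultimately have "[:1, -1:] ^ N dvd q"
      unfolding q_def by (metis dvd_diff dvd_mult dvd_smult dvd_triv_left)
    moreover have "{j. coeff q j \<noteq> 0} = {j. coeff p j \<noteq> 0} - {m}"
      by (auto simp: coeff_q)
    then have "card {j. coeff q j \<noteq> 0} \<le> N"
      using Suc.prems(2) m by (simp add: card_Diff_singleton)
    ultimately have "q = 0" using Suc.IH by blast
    then have "coeff p j = 0" if "j \<noteq> m" for j
      using coeff_q[of j] that by simp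
    then have "p = monom (coeff p m) m" by (intro poly_eqI) auto
    then have "poly p 1 = coeff p m" by (metis poly_monom power_one mult.right_neutral)
    moreover have "poly p 1 = 0" by (simp add: k)
    ultimately show False using m by simp
  qed
qed

text \<open>
  The uniqueness statement on which the identification of the Hankel determinants rests. Division by
  \<open>1 - y\<^sup>3\<close> preserves the condition on the exponents; the quotient has at most \<open>4n + 2\<close> terms but
  vanishes at \<open>1\<close> to order \<open>4n + 2\<close>.
\<close>
lemma exps_mod3_order_eq_0:
  fixes p k :: "real poly"
  assumes exps: "exps_mod3_in {0, 1} p" and deg: "degree p \<le> 6 * n + 4"
    and p: "p = [:1, -1:] ^ (4 * n + 3) * [:1, 1, 1:] * k"
  shows "p = 0"
proof (rule ccontr)
  assume "p \<noteq> 0"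
  define q where "q = [:1, -1:] ^ (4 * n + 2) * k"
  have "[:1, -1:] ^ (4 * n + 3) = [:1, -1:] * [:1, -1:] ^ (4 * n + 2 :: nat)"
    by (metis Suc_eq_plus1 add_Suc_right numeral_3_eq_3 numeral_2_eq_2 power_Suc)
  then have "p = ([:1, -1:] * [:1, 1, 1:]) * q"
    unfolding p q_def \<open>[:1, -1:] ^ (4 * n + 3) = _\<close> by (simp only: mult_ac)
  also have "[:1, -1:] * [:1, 1, 1:] = [:1, 0, 0, -1 :: real:]" by simp
  finally have pq: "p = [:1, 0, 0, -1:] * q" .
  have "q \<noteq> 0" using \<open>p \<noteq> 0\<close> pq by auto
  have "degree p = 3 + degree q"
    unfolding pq using \<open>q \<noteq> 0\<close> by (subst degree_mult_eq) auto
  then have degq: "degree q \<le> 6 * n + 1" using deg by simp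
  have coeff: "coeff p j = coeff q j - (if j < 3 then 0 else coeff q (j - 3))" for j
    by (auto simp: pq coeff_pCons split: nat.splits)
  have "exps_mod3_in {0, 1} q"
    unfolding exps_mod3_in_def
  proof (intro allI impI)
    fix j :: nat assume "j mod 3 \<notin> {0, 1}"
    then show "coeff q j = 0"
    proof (induction j rule: less_induct)
      case (less j)
      have "coeff p j = 0" using exps less.prems by (simp add: exps_mod3_in_def)
      moreover have "coeff q (j - 3) = 0" if "j \<ge> 3"
        using that less.prems by (intro less.IH) (auto simp: le_mod_geq)
      ultimately show ?case using coeff[of j] by (auto split: if_splits)
    qed
  qed
  then have "{j. coeff q j \<noteq> 0} \<subseteq> (\<lambda>(i, e). 3 * i + e) ` ({..2 * n} \<times> {0, 1})"
  proof (intro subsetI)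
    fix j assume exq: "exps_mod3_in {0, 1} q" and "j \<in> {j. coeff q j \<noteq> 0}"
    then have "j \<le> 6 * n + 1" "j mod 3 \<in> {0, 1}"
      using degq le_degree[of q j] by (auto simp: exps_mod3_in_def)
    then have "j div 3 \<le> 2 * n" "j = 3 * (j div 3) + j mod 3" by auto
    then show "j \<in> (\<lambda>(i, e). 3 * i + e) ` ({..2 * n} \<times> {0, 1})"
      using \<open>j mod 3 \<in> {0, 1}\<close> by (intro image_eqI[of _ _ "(j div 3, j mod 3)"]) auto
  qed
  then have "card {j. coeff q j \<noteq> 0} \<le> card ((\<lambda>(i, e). 3 * i + e) ` ({..2 * n} \<times> {0, 1::nat}))"
    by (intro card_mono) auto
  also have "\<dots> \<le> card ({..2 * n} \<times> {0, 1::nat})" by (rule card_image_le) auto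
  also have "\<dots> = 4 * n + 2" by simp
  finally have "q = 0" by (intro sparse_poly_order_eq_0[of "4 * n + 2"]) (simp_all add: q_def)
  then show False using \<open>q \<noteq> 0\<close> by simp
qed

lemma poly_eqI_cofinite:
  fixes p q :: "real poly"
  assumes "finite S" "\<And>y. y \<notin> S \<Longrightarrow> poly p y = poly q y"
  shows "p = q"
proof (rule ccontr)
  assume "p \<noteq> q"
  then have "finite {y. poly (p - q) y = 0}" by (intro poly_roots_finite) simp
  moreover have "UNIV = S \<union> {y. poly (p - q) y = 0}" using assms(2) by auto
  ultimately show False using assms(1) by (metis finite_Un infinite_UNIV_char_0)
qed

text \<open>
  The binary form \<open>\<Sum>j\<le>n. p\<^sub>j a\<^sup>j b\<^sup>n\<^sup>-\<^sup>j\<close>, which equals \<open>b\<^sup>n p(a/b)\<close> if \<open>p\<close> has degree at most \<open>n\<close>;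
  coefficients beyond \<open>n\<close> are ignored.
\<close>
definition homogenize :: "nat \<Rightarrow> real poly \<Rightarrow> real poly \<Rightarrow> real poly \<Rightarrow> real poly" where
  "homogenize n p a b = (\<Sum>j\<le>n. smult (coeff p j) (a ^ j * b ^ (n - j)))"

lemma poly_homogenize:
  assumes "degree p \<le> n" "poly b y \<noteq> 0"
  shows "poly (homogenize n p a b) y = poly b y ^ n * poly p (poly a y / poly b y)"
proof -
  have "poly p x = (\<Sum>j\<le>n. coeff p j * x ^ j)" for x
    unfolding poly_altdef using assms(1)
    by (intro sum.mono_neutral_left) (auto simp: coeff_eq_0)
  moreover have "poly b y ^ n * (poly a y / poly b y) ^ j = poly a y ^ j * poly b y ^ (n - j)" if "j \<le> n" for j
    using that assms(2) by (simp add: power_divide power_diff)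
  ultimately show ?thesis
    unfolding homogenize_def
    by (simp add: poly_sum sum_distrib_left mult.left_commute)
qed

text \<open>Numerator and denominator of the substitution \<open>r = (1 - y)\<^sup>2 / (4 (1 + y + y\<^sup>2))\<close>.\<close>
abbreviation "num_poly \<equiv> [:1, -2, 1 :: real:]"
abbreviation "den_poly \<equiv> [:4, 4, 4 :: real:]"

lemma poly_den_pos: "poly den_poly y > 0"
proof -
  have "poly den_poly y = (2 * y + 1)\<^sup>2 + 3" by (simp add: power2_eq_square algebra_simps)
  also have "\<dots> > 0" by (simp add: add_nonneg_pos)
  finally show ?thesis .
qed

text \<open>
  The chain rule for this substitution, which satisfies
  \<open>y (1 - y) r' = (1 + y) r (4r - 1)\<close>; the derivatives in the ladder relations carry the same factor \<open>r (4r - 1)\<close>.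
\<close>
lemma pderiv_homogenize:
  fixes y :: real
  assumes deg: "degree p \<le> N"
  defines "b \<equiv> poly den_poly y"
  defines "r \<equiv> poly num_poly y / b"
  shows "b * (1 - y) * y * poly (pderiv (homogenize N p num_poly den_poly)) y =
    b ^ N * (N * y * (4 + 8 * y) * (1 - y) * poly p r + b * (1 + y) * r * (4 * r - 1) * poly (pderiv p) r)"
proof -
  let ?b = "\<lambda>y. poly den_poly y" and ?a = "\<lambda>y. poly num_poly y"
  have b: "b > 0" using poly_den_pos by (simp add: b_def)
  define r' where "r' = (poly (pderiv num_poly) y * b - ?a y * poly (pderiv den_poly) y) / b\<^sup>2"
  have "((\<lambda>y. ?a y / ?b y) has_real_derivative r') (at y)"
    unfolding r'_def b_def
    by (rule derivative_eq_intros refl poly_DERIV)+ (use poly_den_pos[of y] in \<open>auto simp: power2_eq_square\<close>)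
  then have "((\<lambda>y. poly p (?a y / ?b y)) has_real_derivative (poly (pderiv p) r * r')) (at y)"
    unfolding r_def b_def by (rule DERIV_chain2[OF poly_DERIV])
  from DERIV_mult[OF DERIV_power[OF poly_DERIV] this, of den_poly N]
  have "((\<lambda>y. ?b y ^ N * poly p (?a y / ?b y)) has_real_derivative
      (real N * b ^ (N - 1) * poly (pderiv den_poly) y * poly p r + b ^ N * (poly (pderiv p) r * r'))) (at y)"
    by (rule DERIV_cong) (simp add: r_def b_def del: poly_pCons)
  moreover have "(\<lambda>y. ?b y ^ N * poly p (?a y / ?b y)) = poly (homogenize N p num_poly den_poly)"
    using poly_den_pos by (intro ext poly_homogenize[symmetric] deg) (auto simp: less_imp_neq[symmetric] simp del: poly_pCons)
  ultimately have D: "poly (pderiv (homogenize N p num_poly den_poly)) y =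
      real N * b ^ (N - 1) * (4 + 8 * y) * poly p r + b ^ N * (poly (pderiv p) r * r')"
    by (auto dest!: DERIV_unique[OF poly_DERIV] simp: pderiv_pCons algebra_simps)
  have r': "y * (1 - y) * r' = (1 + y) * r * (4 * r - 1)"
  proof -
    have "y * (1 - y) * r' = y * (1 - y) * (-12 * (1 - y) * (1 + y)) / b\<^sup>2"
      by (simp add: r'_def b_def pderiv_pCons) (auto simp: algebra_simps power2_eq_square)
    also have "\<dots> = (1 + y) * (1 - y)\<^sup>2 * (4 * (1 - y)\<^sup>2 - b) / b\<^sup>2"
      by (simp add: b_def) (auto simp: algebra_simps power2_eq_square)
    also have "\<dots> = (1 + y) * r * (4 * r - 1)"
      using b by (simp add: r_def field_simps power2_eq_square)
    finally show ?thesis .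
  qed
  have N: "b * (real N * b ^ (N - 1)) = real N * b ^ N" by (cases N) simp_all
  have "b * (1 - y) * y * poly (pderiv (homogenize N p num_poly den_poly)) y =
     (b * (real N * b ^ (N - 1))) * (y * (1 - y) * (4 + 8 * y) * poly p r) + b ^ N * b * poly (pderiv p) r * (y * (1 - y) * r')"
    unfolding D by (simp add: algebra_simps)
  then show ?thesis unfolding N r' by (simp add: algebra_simps)
qed

section \<open>The hypergeometric polynomials in the uniformising variable\<close>

text \<open>
  The polynomials \<open>A\<^sub>n\<close> and \<open>B\<^sub>n\<close> pulled back along \<open>r = (1 - y)\<^sup>2 / (4 (1 + y + y\<^sup>2))\<close>, with the prefactors for which the
  exponents congruent to 2 modulo 3 disappear. With \<open>y = e\<^sup>2\<^sup>i\<^sup>\<psi>\<close> and up to a monomial factor,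
  differentiation with respect to \<open>cos 3\<psi>\<close> leads down the ladder
  \<open>\<dots>, A_lift 1, B_lift 1, A_lift 0, B_lift 0\<close>.
\<close>
definition A_lift :: "nat \<Rightarrow> real poly" where
  "A_lift n = [:1, 1:] * [:1, -1:] ^ (4 * n + 3) * homogenize n (A_poly n) num_poly den_poly"

definition B_lift :: "nat \<Rightarrow> real poly" where
  "B_lift n = [:1, -1:] ^ (4 * n + 1) * homogenize n (B_poly n) num_poly den_poly"

lemma poly_one_minus_power_mult:
  fixes y :: real
  shows "poly ([:1, -1:] ^ Suc m * h) y = (1 - y) * (1 - y) ^ m * poly h y"
    and "poly (pderiv ([:1, -1:] ^ Suc m * h)) y =
    - real (Suc m) * (1 - y) ^ m * poly h y + (1 - y) * (1 - y) ^ m * poly (pderiv h) y"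
proof -
  show "poly (pderiv ([:1, -1:] ^ Suc m * h)) y =
    - real (Suc m) * (1 - y) ^ m * poly h y + (1 - y) * (1 - y) ^ m * poly (pderiv h) y"
    unfolding pderiv_mult pderiv_power_Suc poly_mult poly_add poly_smult poly_power
    by (simp add: pderiv_pCons algebra_simps)
qed (simp add: algebra_simps)

text \<open>
  The differential relations of the ladder after the substitution. Since \<open>1 - y\<^sup>3\<close> is a polynomial in \<open>y\<^sup>3\<close>, they
  propagate the condition on the exponents.
\<close>
lemma B_lift_deriv_rel:
  "[:0, 1:] * pderiv (B_lift (Suc n)) - smult ((6 * real n + 7) / 2) (B_lift (Suc n)) =
   smult (- 2 * (4 * real n + 5)) ([:1, 0, 0, -1:] * A_lift n)" (is "?L = ?R")
proof (rule poly_eqI_cofinite[of "{}"])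
  fix y :: real
  define W b r where "W = 1 - y" and "b = poly den_poly y" and "r = poly num_poly y / b"
  let ?p = "B_poly (Suc n)"
  define h where "h = homogenize (Suc n) ?p num_poly den_poly"
  have b: "b > 0" and b_eq: "b = 4 * (1 + y + y\<^sup>2)"
    using poly_den_pos[of y] by (simp_all add: b_def algebra_simps power2_eq_square)
  have rb: "r * b = W\<^sup>2"
  proof -
    have "poly num_poly y = W\<^sup>2" by (simp add: W_def power2_eq_square algebra_simps)
    then show ?thesis using b by (simp add: r_def del: poly_pCons)
  qed
  have cube: "1 - y ^ 3 = W * b / 4"
    by (simp add: b_eq W_def power2_eq_square power3_eq_cube algebra_simps)
  have h: "poly h y = b ^ Suc n * poly ?p r"
    unfolding h_def r_def b_def using b degree_B_poly_le
    by (intro poly_homogenize) (auto simp: b_def simp del: poly_pCons)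
  have hA: "poly (homogenize n (A_poly n) num_poly den_poly) y = b ^ n * poly (A_poly n) r"
    unfolding r_def b_def using b degree_A_poly
    by (intro poly_homogenize) (auto simp: b_def simp del: poly_pCons)
  have h': "b * W * y * poly (pderiv h) y =
    b ^ Suc n * (Suc n * y * (4 + 8 * y) * W * poly ?p r + b * (1 + y) * r * (4 * r - 1) * poly (pderiv ?p) r)"
    unfolding h_def r_def b_def W_def by (rule pderiv_homogenize) (rule degree_B_poly_le)
  have A: "(4 * real n + 5) * poly (A_poly n) r =
     (4 * real n + 5 + 8 * Suc n * r) * poly ?p r + (2 * r - 8 * r\<^sup>2) * poly (pderiv ?p) r"
    using arg_cong[OF B_poly_deriv_rel[of n], of "\<lambda>p. poly p r"]
    by (simp add: algebra_simps power2_eq_square)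
  have B_lift: "B_lift (Suc n) = [:1, -1:] ^ Suc (4 * n + 4) * h"
    by (simp add: B_lift_def h_def)
  have B_lift_y: "poly (B_lift (Suc n)) y = W * W ^ (4 * n + 4) * poly h y"
    "poly (pderiv (B_lift (Suc n))) y =
      - (4 * real n + 5) * W ^ (4 * n + 4) * poly h y + W * W ^ (4 * n + 4) * poly (pderiv h) y"
    unfolding B_lift poly_one_minus_power_mult W_def by simp_all
  have pow: "W ^ (4 * n + 4) = W * W ^ (4 * n + 3)"
    by (metis Suc_eq_plus1 add_Suc_right numeral_3_eq_3 numeral_eq_Suc power_Suc pred_numeral_simps(2) semiring_norm(26,27))
  have "b * poly ?L y = W ^ (4 * n + 4) *
     ((- (4 * real n + 5) * y * b - (6 * real n + 7) / 2 * W * b) * poly h y + b * W * y * poly (pderiv h) y)"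
    unfolding poly_diff poly_smult poly_mult[of _ "pderiv _"] B_lift_y by (simp add: field_simps)
  also have "\<dots> = W ^ (4 * n + 4) * b ^ Suc n *
     ((- (4 * real n + 5) * y * b - (6 * real n + 7) / 2 * W * b + Suc n * y * (4 + 8 * y) * W) * poly ?p r
      + b * (1 + y) * r * (4 * r - 1) * poly (pderiv ?p) r)"
    unfolding h h' by (simp only: ring_distribs mult_ac)
  also have "- (4 * real n + 5) * y * b - (6 * real n + 7) / 2 * W * b + Suc n * y * (4 + 8 * y) * W =
     - (1 + y) / 2 * ((4 * real n + 5) * b + 8 * Suc n * W\<^sup>2)"
    by (simp add: b_eq W_def power2_eq_square field_simps)
  also have "\<dots> = - (1 + y) / 2 * b * (4 * real n + 5 + 8 * Suc n * r)"
    unfolding rb[symmetric] by (simp add: algebra_simps)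
  also have "W ^ (4 * n + 4) * b ^ Suc n * (- (1 + y) / 2 * b * (4 * real n + 5 + 8 * Suc n * r) * poly ?p r
      + b * (1 + y) * r * (4 * r - 1) * poly (pderiv ?p) r) =
      W ^ (4 * n + 4) * b ^ Suc n * (- (1 + y) / 2 * b * ((4 * real n + 5) * poly (A_poly n) r))"
    unfolding A by (simp add: field_simps power2_eq_square)
  also have "\<dots> = - 2 * (4 * real n + 5) * ((W * b / 4) * ((1 + y) * W ^ (4 * n + 3) * (b ^ n * poly (A_poly n) r))) * b"
    unfolding pow by (simp add: field_simps)
  also have "\<dots> = b * poly ?R y"
    unfolding A_lift_def cube[symmetric] hA[symmetric]
    by (simp add: W_def power3_eq_cube algebra_simps)
  finally show "poly ?L y = poly ?R y" using b by (simp only: mult_cancel_left) simp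
qed simp

lemma A_lift_deriv_rel:
  "[:0, 1:] * pderiv (A_lift n) - smult (3 * real n + 2) (A_lift n) =
   smult (- (2 / 3) * (4 * real n + 3)) ([:1, 0, 0, -1:] * B_lift n)" (is "?L = ?R")
proof (rule poly_eqI_cofinite[of "{}"])
  fix y :: real
  define W b r where "W = 1 - y" and "b = poly den_poly y" and "r = poly num_poly y / b"
  let ?p = "A_poly n"
  define h where "h = homogenize n ?p num_poly den_poly"
  have b: "b > 0" and b_eq: "b = 4 * (1 + y + y\<^sup>2)"
    using poly_den_pos[of y] by (simp_all add: b_def algebra_simps power2_eq_square)
  have rb: "r * b = W\<^sup>2"
  proof -
    have "poly num_poly y = W\<^sup>2" by (simp add: W_def power2_eq_square algebra_simps)
    then show ?thesis using b by (simp add: r_def del: poly_pCons)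
  qed
  have rb': "b * (1 - r) = 3 * (1 + y)\<^sup>2"
    using rb by (simp add: b_eq W_def power2_eq_square algebra_simps)
  have cube: "1 - y ^ 3 = W * b / 4"
    by (simp add: b_eq W_def power2_eq_square power3_eq_cube algebra_simps)
  have h: "poly h y = b ^ n * poly ?p r"
    unfolding h_def r_def b_def using b degree_A_poly
    by (intro poly_homogenize) (auto simp: b_def simp del: poly_pCons)
  have hB: "poly (homogenize n (B_poly n) num_poly den_poly) y = b ^ n * poly (B_poly n) r"
    unfolding r_def b_def using b degree_B_poly_le
    by (intro poly_homogenize) (auto simp: b_def simp del: poly_pCons)
  have h': "b * W * y * poly (pderiv h) y =
    b ^ n * (n * y * (4 + 8 * y) * W * poly ?p r + b * (1 + y) * r * (4 * r - 1) * poly (pderiv ?p) r)"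
    unfolding h_def r_def b_def W_def by (rule pderiv_homogenize) (simp add: degree_A_poly)
  have B: "(4 * real n + 3) * poly (B_poly n) r =
     3 * r * poly ?p r + (1 - r) * ((4 * real n + 3 + 8 * n * r) * poly ?p r + (2 * r - 8 * r\<^sup>2) * poly (pderiv ?p) r)"
    using arg_cong[OF A_poly_deriv_rel[of n], of "\<lambda>p. poly p r"]
    by (simp add: algebra_simps power2_eq_square)
  have A_lift: "A_lift n = [:1, 1:] * ([:1, -1:] ^ Suc (4 * n + 2) * h)"
  proof -
    have "4 * n + 3 = Suc (4 * n + 2)" by simp
    then show ?thesis unfolding A_lift_def h_def by (simp only: mult.assoc)
  qed
  have A_lift_y: "poly (A_lift n) y = (1 + y) * (W * W ^ (4 * n + 2)) * poly h y"
    "poly (pderiv (A_lift n)) y = W * W ^ (4 * n + 2) * poly h y + (1 + y) *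
      (- (4 * real n + 3) * W ^ (4 * n + 2) * poly h y + W * W ^ (4 * n + 2) * poly (pderiv h) y)"
    unfolding A_lift pderiv_mult[of "[:1, 1:]"] poly_add poly_mult[of "[:1, 1:]"] poly_mult[of _ "pderiv [:1, 1:]"]
      poly_one_minus_power_mult
    by (simp_all add: W_def pderiv_pCons algebra_simps)
  have pow: "W ^ (4 * n + 2) = W * W ^ (4 * n + 1)"
    by simp
  have "b * poly ?L y = W ^ (4 * n + 2) *
     ((y * W * b - (1 + y) * (4 * real n + 3) * y * b - (3 * real n + 2) * (1 + y) * W * b) * poly h y
      + (1 + y) * (b * W * y * poly (pderiv h) y))"
    unfolding poly_diff poly_smult poly_mult[of _ "pderiv _"] A_lift_y by (simp add: field_simps)
  also have "\<dots> = W ^ (4 * n + 2) * b ^ n *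
     ((y * W * b - (1 + y) * (4 * real n + 3) * y * b - (3 * real n + 2) * (1 + y) * W * b
        + (1 + y) * n * y * (4 + 8 * y) * W) * poly ?p r
      + b * (1 + y)\<^sup>2 * r * (4 * r - 1) * poly (pderiv ?p) r)"
    unfolding h h' power2_eq_square by (simp only: ring_distribs mult_ac)
  also have "y * W * b - (1 + y) * (4 * real n + 3) * y * b - (3 * real n + 2) * (1 + y) * W * b
        + (1 + y) * n * y * (4 + 8 * y) * W =
     - (1 / 6) * (3 * b * W\<^sup>2 + 3 * (1 + y)\<^sup>2 * ((4 * real n + 3) * b + 8 * n * W\<^sup>2))"
    by (simp add: b_eq W_def power2_eq_square field_simps)
  also have "\<dots> = - (1 / 6) * b\<^sup>2 * (3 * r + (1 - r) * (4 * real n + 3 + 8 * n * r))"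
    unfolding rb[symmetric] rb'[symmetric] by (simp add: algebra_simps power2_eq_square)
  also have "b * (1 + y)\<^sup>2 * r * (4 * r - 1) = - (1 / 6) * b\<^sup>2 * ((1 - r) * (2 * r - 8 * r\<^sup>2))"
  proof -
    have "(1 + y)\<^sup>2 = b * (1 - r) / 3" using rb' by simp
    then show ?thesis by (simp only:) (simp add: power2_eq_square field_simps)
  qed
  also have "W ^ (4 * n + 2) * b ^ n * (- (1 / 6) * b\<^sup>2 * (3 * r + (1 - r) * (4 * real n + 3 + 8 * n * r)) * poly ?p r
      + - (1 / 6) * b\<^sup>2 * ((1 - r) * (2 * r - 8 * r\<^sup>2)) * poly (pderiv ?p) r) =
      W ^ (4 * n + 2) * b ^ n * (- (1 / 6) * b\<^sup>2 * ((4 * real n + 3) * poly (B_poly n) r))"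
    unfolding B by (simp only: ring_distribs mult_ac)
  also have "\<dots> = - (2 / 3) * (4 * real n + 3) * ((W * b / 4) * (W ^ (4 * n + 1) * (b ^ n * poly (B_poly n) r))) * b"
    unfolding pow by (simp add: power2_eq_square)
  also have "\<dots> = b * poly ?R y"
    unfolding B_lift_def cube[symmetric] hB[symmetric]
    by (simp add: W_def power3_eq_cube algebra_simps)
  finally show "poly ?L y = poly ?R y" using b by (simp only: mult_cancel_left) simp
qed simp

lemma antipalindromic_coeff_eq_0:
  fixes p :: "real poly"
  assumes deg: "degree p \<le> 2 * c" and anti: "\<And>y. y \<noteq> 0 \<Longrightarrow> y ^ (2 * c) * poly p (1 / y) = - poly p y"
  shows "coeff p c = 0"
proof -
  define q where "q = (\<Sum>j\<le>2 * c. monom (coeff p j) (2 * c - j))"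
  have "poly q y = - poly p y" if "y \<noteq> 0" for y
  proof -
    have "poly p (1 / y) = (\<Sum>j\<le>2 * c. coeff p j * (1 / y) ^ j)"
      unfolding poly_altdef using deg by (intro sum.mono_neutral_left) (auto simp: coeff_eq_0)
    then have "y ^ (2 * c) * poly p (1 / y) = poly q y"
      unfolding q_def poly_sum poly_monom using that
      by (simp add: sum_distrib_left power_divide power_diff mult.commute)
    then show ?thesis using anti[OF that] by simp
  qed
  then have "q = - p" by (intro poly_eqI_cofinite[of "{0}"]) auto
  moreover have "coeff q c = (\<Sum>j\<le>2 * c. if j = c then coeff p j else 0)"
    unfolding q_def coeff_sum by (intro sum.cong) auto
  then have "coeff q c = coeff p c" by simp
  ultimately show ?thesis by simp
qed

lemma degree_homogenize_le:
  assumes "degree a \<le> 2" "degree b \<le> 2"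
  shows "degree (homogenize n p a b) \<le> 2 * n"
  unfolding homogenize_def
proof (rule degree_sum_le)
  fix j assume "j \<in> {..n}"
  have "degree (a ^ j * b ^ (n - j)) \<le> degree (a ^ j) + degree (b ^ (n - j))"
    by (rule degree_mult_le)
  also have "\<dots> \<le> 2 * j + 2 * (n - j)"
    using degree_power_le[of a j] degree_power_le[of b "n - j"] assms
    by (intro add_mono) (meson mult_le_mono1 order_trans)+
  also have "\<dots> = 2 * n" using \<open>j \<in> {..n}\<close> by simp
  finally show "degree (smult (coeff p j) (a ^ j * b ^ (n - j))) \<le> 2 * n"
    using degree_smult_le order_trans by blast
qed simp

lemma degree_A_lift: "degree (A_lift n) \<le> 6 * n + 4"
proof -
  have "degree (A_lift n) \<le> (degree [:1, 1::real:] + degree ([:1, -1::real:] ^ (4 * n + 3))) + 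
     degree (homogenize n (A_poly n) num_poly den_poly)"
    unfolding A_lift_def by (intro order_trans[OF degree_mult_le] add_mono degree_mult_le order_refl)
  also have "\<dots> \<le> (1 + (4 * n + 3)) + 2 * n"
    using degree_power_le[of "[:1, -1::real:]" "4 * n + 3"]
    by (intro add_mono degree_homogenize_le) auto
  finally show ?thesis by simp
qed

lemma A_lift_antipalindromic:
  assumes y: "y \<noteq> 0"
  shows "y ^ (2 * (3 * n + 2)) * poly (A_lift n) (1 / y) = - poly (A_lift n) y"
proof -
  have b: "y\<^sup>2 * poly den_poly (1 / y) = poly den_poly y"
    and a: "y\<^sup>2 * poly num_poly (1 / y) = poly num_poly y"
    using y by (auto simp: field_simps power2_eq_square)
  have ab: "poly num_poly (1 / y) / poly den_poly (1 / y) = poly num_poly y / poly den_poly y"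
    unfolding a[symmetric] b[symmetric] using y by simp
  have hom: "poly (homogenize n (A_poly n) num_poly den_poly) x =
     poly den_poly x ^ n * poly (A_poly n) (poly num_poly x / poly den_poly x)" for x
    using poly_den_pos[of x] degree_A_poly
    by (intro poly_homogenize) (auto simp del: poly_pCons)
  have lin: "y * poly [:1, 1:] (1 / y) = 1 + y" "y * poly [:1, -1:] (1 / y) = - (1 - y)"
    using y by (simp_all add: field_simps)
  have e: "y ^ (2 * (3 * n + 2)) = y * y ^ (4 * n + 3) * (y\<^sup>2) ^ n"
    unfolding power_mult[symmetric] power_Suc[symmetric] power_add[symmetric]
    by (rule arg_cong[where f = "\<lambda>k. y ^ k"]) simp
  have "y ^ (2 * (3 * n + 2)) * poly (A_lift n) (1 / y) =
     (y * poly [:1, 1:] (1 / y)) * (y * poly [:1, -1:] (1 / y)) ^ (4 * n + 3) *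
     ((y\<^sup>2 * poly den_poly (1 / y)) ^ n * poly (A_poly n) (poly num_poly (1 / y) / poly den_poly (1 / y)))"
    unfolding e A_lift_def poly_mult hom poly_power power_mult_distrib by (simp only: mult_ac)
  also have "\<dots> = (1 + y) * (- (1 - y)) ^ (4 * n + 3) *
      (poly den_poly y ^ n * poly (A_poly n) (poly num_poly y / poly den_poly y))"
    unfolding b ab lin ..
  also have "(- (1 - y)) ^ (4 * n + 3) = - ((1 - y) ^ (4 * n + 3))"
    by (rule power_minus_odd) simp
  finally show ?thesis unfolding A_lift_def poly_mult hom by (simp add: algebra_simps)
qed

text \<open>
  The operator \<open>y d/dy - c\<close> multiplies the coefficient of \<open>y\<^sup>j\<close> by \<open>j - c\<close>. The only exponent
  congruent to 2 modulo 3 with \<open>j = c\<close> is the central one, \<open>3n + 2\<close>, of \<open>A_lift n\<close>; its coefficient vanishes by antisymmetry.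
\<close>
lemma exps_A_lift: "exps_mod3_in {0, 1} (A_lift n)"
  and exps_B_lift: "exps_mod3_in {0, 1} (B_lift n)"
proof -
  have A: "exps_mod3_in {0, 1} (A_lift n)" if "exps_mod3_in {0, 1} (B_lift n)" for n
    unfolding exps_mod3_in_def
  proof (intro allI impI)
    fix j :: nat assume j: "j mod 3 \<notin> {0, 1}"
    have "exps_mod3_in {0, 1} ([:0, 1:] * pderiv (A_lift n) - smult (3 * real n + 2) (A_lift n))"
      unfolding A_lift_deriv_rel by (intro exps_mod3_in_smult exps_mod3_in_mult exps_mod3_in_cubic that)
    then have "coeff ([:0, 1:] * pderiv (A_lift n) - smult (3 * real n + 2) (A_lift n)) j = 0"
      using j unfolding exps_mod3_in_def by blast
    then have "(real j - (3 * real n + 2)) * coeff (A_lift n) j = 0"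
      by (cases j) (simp_all add: coeff_pderiv algebra_simps)
    moreover have "coeff (A_lift n) (3 * n + 2) = 0"
      by (intro antipalindromic_coeff_eq_0 A_lift_antipalindromic) (use degree_A_lift[of n] in auto)
    ultimately show "coeff (A_lift n) j = 0" by (cases "j = 3 * n + 2") auto
  qed
  have B: "exps_mod3_in {0, 1} (B_lift (Suc n))" if "exps_mod3_in {0, 1} (A_lift n)" for n
    unfolding exps_mod3_in_def
  proof (intro allI impI)
    fix j :: nat assume j: "j mod 3 \<notin> {0, 1}"
    have "exps_mod3_in {0, 1} ([:0, 1:] * pderiv (B_lift (Suc n)) - smult ((6 * real n + 7) / 2) (B_lift (Suc n)))"
      unfolding B_lift_deriv_rel by (intro exps_mod3_in_smult exps_mod3_in_mult exps_mod3_in_cubic that)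
    then have "coeff ([:0, 1:] * pderiv (B_lift (Suc n)) - smult ((6 * real n + 7) / 2) (B_lift (Suc n))) j = 0"
      using j unfolding exps_mod3_in_def by blast
    then have "(real j - (6 * real n + 7) / 2) * coeff (B_lift (Suc n)) j = 0"
      by (cases j) (simp_all add: coeff_pderiv algebra_simps)
    moreover have "real j \<noteq> (6 * real n + 7) / 2"
    proof
      assume "real j = (6 * real n + 7) / 2"
      then have "real (2 * j) = real (6 * n + 7)" by simp
      then have "2 * j = 6 * n + 7" by (simp only: of_nat_eq_iff)
      then show False by presburger
    qed
    ultimately show "coeff (B_lift (Suc n)) j = 0" by auto
  qed
  have 0: "exps_mod3_in {0, 1} (B_lift 0)"
    by (auto simp: B_lift_def homogenize_def exps_mod3_in_def coeff_pCons split: nat.splits)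
  show B_lift: "exps_mod3_in {0, 1} (B_lift n)"
    by (induction n) (use 0 A B in auto)
  show "exps_mod3_in {0, 1} (A_lift n)" using A B_lift .
qed

section \<open>Pade approximation from the kernel of the Hankel matrix\<close>

text \<open>The power series of \<open>(1 - z)\<^sup>-\<^sup>r\<^sup>-\<^sup>1\<close>.\<close>
definition negbin :: "nat \<Rightarrow> real fps" where
  "negbin r = Abs_fps (\<lambda>i. of_nat ((r + i) choose i))"

text \<open>The power series of \<open>1 / (1 - xz)\<close>.\<close>
definition geo :: "real \<Rightarrow> real fps" where
  "geo x = Abs_fps (\<lambda>i. x ^ i)"

lemma negbin_Suc: "(1 - fps_X) * negbin (Suc r) = negbin r"
proof (rule fps_ext)
  fix i show "fps_nth ((1 - fps_X) * negbin (Suc r)) i = fps_nth (negbin r) i"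
    by (cases i) (simp_all add: negbin_def algebra_simps)
qed

lemma negbin_add: "(1 - fps_X) ^ s * negbin (r + s) = negbin r"
proof (induction s)
  case (Suc s)
  have "(1 - fps_X) ^ Suc s * negbin (r + Suc s) = (1 - fps_X) ^ s * ((1 - fps_X) * negbin (Suc (r + s)))"
    by (simp add: mult_ac)
  then show ?case using Suc by (simp add: negbin_Suc)
qed simp

lemma geo: "(1 - fps_const x * fps_X) * geo x = 1"
proof (rule fps_ext)
  fix i show "fps_nth ((1 - fps_const x * fps_X) * geo x) i = fps_nth 1 i"
    by (cases i) (simp_all add: geo_def algebra_simps)
qed

text \<open>
  The coefficient of \<open>z\<^sup>m\<close> in \<open>f(z) (1 - z)\<^sup>-\<^sup>2\<^sup>m\<^sup>-\<^sup>2 / (1 - xz)\<close>. With \<open>t = z (1 - z)\<^sup>2\<close> and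
  \<open>g = (1 - z) (1 - 3z) (1 - xz)\<close> this is the coefficient of \<open>t\<^sup>m\<close> in the expansion of \<open>f / g\<close> in powers of \<open>t\<close>,
  as in Lagrange inversion. It sends \<open>t\<^sup>i\<close> to \<open>a\<^sub>m\<^sub>-\<^sub>i(x)\<close> (to \<open>0\<close> if \<open>i > m\<close>) and \<open>g t\<^sup>i\<close> to the Kronecker delta.
\<close>
definition coeff_functional :: "real \<Rightarrow> nat \<Rightarrow> real poly \<Rightarrow> real" where
  "coeff_functional x m f = fps_nth (fps_of_poly f * (negbin (2 * m + 1) * geo x)) m"

lemma coeff_functional_linear:
  "coeff_functional x m (f - g) = coeff_functional x m f - coeff_functional x m g"
  "coeff_functional x m (\<Sum>i\<in>I. f' i) = (\<Sum>i\<in>I. coeff_functional x m (f' i))"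
  "coeff_functional x m (smult c f) = c * coeff_functional x m f"
  unfolding coeff_functional_def fps_of_poly_diff fps_of_poly_sum fps_of_poly_smult
    sum_distrib_right fps_sum_nth left_diff_distrib fps_sub_nth
  by (simp_all add: mult.assoc)

lemma coeff_functional_low_order:
  assumes "\<And>k. k < m \<Longrightarrow> coeff f k = 0"
  shows "coeff_functional x m f = coeff f m"
proof -
  have "coeff_functional x m f = (\<Sum>i=0..m. if i = m then coeff f m else 0)"
    unfolding coeff_functional_def fps_mult_nth[of "fps_of_poly f"]
    by (intro sum.cong) (use assms in \<open>auto simp: negbin_def geo_def\<close>)
  then show ?thesis by simp
qed

lemma coeff_functional_eq_0_imp_coeff:
  assumes "\<And>k. k < m \<Longrightarrow> coeff_functional x k f = 0"
  shows "\<And>k. k < m \<Longrightarrow> coeff f k = 0" "coeff_functional x m f = coeff f m"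
proof -
  show 1: "coeff f k = 0" if "k < m" for k
    using that
  proof (induction k rule: less_induct)
    case (less k)
    then have "coeff_functional x k f = coeff f k"
      by (intro coeff_functional_low_order) auto
    then show ?case using assms less.prems by simp
  qed
  show "coeff_functional x m f = coeff f m"
    by (rule coeff_functional_low_order) (rule 1)
qed

lemma poly_a_poly: "poly (a_poly k) x = fps_nth (negbin (2 * k + 1) * geo x) k"
proof -
  have "poly (a_poly k) x = (\<Sum>i=0..k. of_nat ((3 * k + 1 - i) choose (k - i)) * x ^ i)"
    by (simp add: a_poly_def poly_sum poly_monom atMost_atLeast0)
  also have "\<dots> = fps_nth (geo x * negbin (2 * k + 1)) k"
    unfolding fps_mult_nth
  proof (rule sum.cong)
    fix i assume "i \<in> {0..k}"
    then have "3 * k + 1 - i = 2 * k + 1 + (k - i)" by simp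
    then show "real ((3 * k + 1 - i) choose (k - i)) * x ^ i = fps_nth (geo x) i * fps_nth (negbin (2 * k + 1)) (k - i)"
      by (simp add: geo_def negbin_def)
  qed simp
  finally show ?thesis by (simp add: mult.commute)
qed

text \<open>The polynomials \<open>t = z (1 - z)\<^sup>2\<close> and \<open>g = (1 - z) (1 - 3z) (1 - xz)\<close> in \<open>z\<close>.\<close>
abbreviation "t_poly \<equiv> [:0, 1, -2, 1 :: real:]"
abbreviation "g_poly x \<equiv> [:1, -1:] * [:1, -3:] * [:1, - (x :: real):]"

lemma fps_of_poly_t_power: "fps_of_poly (t_poly ^ i) = fps_X ^ i * (1 - fps_X) ^ (2 * i)"
proof -
  have t: "t_poly = [:0, 1:] * [:1, -1:] ^ 2" by (simp add: power2_eq_square)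
  show ?thesis
    unfolding t fps_of_poly_power fps_of_poly_mult power_mult_distrib
    by (simp add: fps_of_poly_pCons power_mult)
qed

lemma coeff_functional_t_power:
  "coeff_functional x m (t_poly ^ i) = (if i \<le> m then poly (a_poly (m - i)) x else 0)"
proof (cases "i \<le> m")
  case True
  then have m: "2 * m + 1 = 2 * (m - i) + 1 + 2 * i" by simp
  have eq: "fps_of_poly (t_poly ^ i) * (negbin (2 * m + 1) * geo x) =
     fps_X ^ i * (((1 - fps_X) ^ (2 * i) * negbin (2 * (m - i) + 1 + 2 * i)) * geo x)"
    unfolding fps_of_poly_t_power m by (simp only: mult_ac)
  show ?thesis
    unfolding coeff_functional_def eq negbin_add using True
    by (simp add: poly_a_poly fps_X_power_mult_nth mult.assoc)
next
  case False
  then show ?thesis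
    by (simp add: coeff_functional_def fps_of_poly_t_power mult.assoc fps_X_power_mult_nth)
qed

lemma coeff_functional_g_t_power:
  "coeff_functional x m (g_poly x * t_poly ^ i) = (if i = m then 1 else 0)"
proof -
  have lin: "fps_of_poly [:1, -c:] = 1 - fps_const c * fps_X" for c :: real
    by (simp add: fps_of_poly_pCons flip: fps_const_neg)
  have eq: "fps_of_poly (g_poly x * t_poly ^ i) * (negbin (2 * m + 1) * geo x) =
    fps_X ^ i * (1 - fps_const 3 * fps_X) * ((1 - fps_X) ^ (2 * i + 1) * negbin (2 * m + 1)) *
     ((1 - fps_const x * fps_X) * geo x)"
    unfolding fps_of_poly_mult fps_of_poly_t_power lin
    by (simp add: mult_ac)
  have *: "coeff_functional x m (g_poly x * t_poly ^ i) =
     fps_nth (fps_X ^ i * ((1 - fps_const 3 * fps_X) * ((1 - fps_X) ^ (2 * i + 1) * negbin (2 * m + 1)))) m"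
    unfolding coeff_functional_def eq geo mult_1_right by (simp only: mult.assoc)
  show ?thesis
  proof (cases "i \<le> m")
    case True
    define e where "e = m - i"
    have m: "m = i + e" "2 * m + 1 = 2 * e + (2 * i + 1)" using True by (auto simp: e_def)
    have "coeff_functional x m (g_poly x * t_poly ^ i) = fps_nth ((1 - fps_const 3 * fps_X) * negbin (2 * e)) e"
      unfolding * m(2) negbin_add by (simp add: fps_X_power_mult_nth m(1))
    also have "\<dots> = (if e = 0 then 1 else 0)"
    proof (cases e)
      case 0
      then show ?thesis by (simp add: negbin_def)
    next
      case (Suc d)
      \<comment> \<open>the coefficient in question is \<open>(3e choose e) - 3 (3e-1 choose e-1)\<close> with \<open>e = d + 1\<close>\<close>
      have "Suc d * (Suc (3 * d + 2) choose Suc d) = Suc (3 * d + 2) * (3 * d + 2 choose d)"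
        by (rule Suc_times_binomial)
      then have "Suc d * (Suc (3 * d + 2) choose Suc d) = Suc d * (3 * (3 * d + 2 choose d))"
        by simp
      then have "(Suc (3 * d + 2) choose Suc d) = 3 * (3 * d + 2 choose d)"
        by (simp only: mult_cancel1) simp
      then have "real (3 * d + 3 choose (Suc d)) = 3 * real (3 * d + 2 choose d)"
        by (simp add: eval_nat_numeral)
      moreover have "2 * Suc d + Suc d = 3 * d + 3" "2 * Suc d + d = 3 * d + 2" by simp_all
      ultimately have "fps_nth (negbin (2 * Suc d)) (Suc d) = 3 * fps_nth (negbin (2 * Suc d)) d"
        by (simp only: negbin_def fps_nth_Abs_fps)
      then show ?thesis unfolding Suc left_diff_distrib by (simp add: mult.assoc)
    qed
    also have "\<dots> = (if i = m then 1 else 0)" using m(1) by simp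
    finally show ?thesis .
  next
    case False
    then show ?thesis unfolding * by (simp add: fps_X_power_mult_nth)
  qed
qed

text \<open>
  Pade approximation: if \<open>p\<close> is orthogonal to the first \<open>n\<close> rows of the Hankel matrix, then the polynomial
  \<open>\<Sum>j. p\<^sub>j t\<^sup>n\<^sup>-\<^sup>j\<close> agrees with \<open>g\<close> times a polynomial in \<open>t\<close> up to order \<open>z\<^sup>2\<^sup>n\<close>. The remainder \<open>z\<^sup>2\<^sup>n N(z)\<close> has
  degree at most \<open>3n\<close>; \<open>N(0)\<close> is the product of \<open>p\<close> with the next row, and \<open>N(1) = p\<^sub>n\<close>
  because \<open>t\<close> and \<open>g\<close> vanish at \<open>z = 1\<close>.
\<close>
lemma hankel_kernel_remainder:
  fixes p :: "nat \<Rightarrow> real"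
  assumes n: "n > 0" and orth: "\<And>i. i < n \<Longrightarrow> (\<Sum>j\<le>n. poly (a_poly (i + j)) x * p j) = 0"
  obtains q N where
    "(\<Sum>j\<le>n. smult (p j) (t_poly ^ (n - j))) - (\<Sum>i<n. smult (q i) (g_poly x * t_poly ^ i)) = monom 1 (2 * n) * N"
    "degree N \<le> n" "poly N 0 = (\<Sum>j\<le>n. poly (a_poly (n + j)) x * p j)" "poly N 1 = p n"
proof -
  define P where "P = (\<Sum>j\<le>n. smult (p j) (t_poly ^ (n - j)))"
  define q where "q i = coeff_functional x i P" for i
  define Q where "Q = (\<Sum>i<n. smult (q i) (g_poly x * t_poly ^ i))"
  have P: "coeff_functional x (n + i) P = (\<Sum>j\<le>n. poly (a_poly (i + j)) x * p j)" for i
    unfolding P_def coeff_functional_linear coeff_functional_t_power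
    by (intro sum.cong) (auto intro!: arg_cong[where f = "\<lambda>k. poly (a_poly k) x"])
  have Q: "coeff_functional x m Q = (if m < n then q m else 0)" for m
    unfolding Q_def coeff_functional_linear coeff_functional_g_t_power
    by (simp add: if_distrib cong: if_cong)
  have 0: "coeff_functional x m (P - Q) = 0" if "m < 2 * n" for m
  proof (cases "m < n")
    case True
    then show ?thesis by (simp add: coeff_functional_linear(1) Q q_def)
  next
    case False
    then have "coeff_functional x m P = 0"
      using P[of "m - n"] orth[of "m - n"] that by simp
    then show ?thesis using False by (simp add: coeff_functional_linear(1) Q)
  qed
  have low: "coeff (P - Q) k = 0" if "k < 2 * n" for k
    using coeff_functional_eq_0_imp_coeff(1)[OF 0] that by blast
  have "coeff (P - Q) (2 * n) = coeff_functional x (n + n) (P - Q)"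
    using coeff_functional_eq_0_imp_coeff(2)[OF 0, of "2 * n"] by (simp add: mult_2)
  then have top: "coeff (P - Q) (2 * n) = (\<Sum>j\<le>n. poly (a_poly (n + j)) x * p j)"
    by (simp add: coeff_functional_linear(1) P Q)
  have "monom 1 (2 * n) dvd P - Q" using low by (simp add: monom_1_dvd_iff')
  then obtain N where N: "P - Q = monom 1 (2 * n) * N" by auto
  have degt: "degree (t_poly ^ i) \<le> 3 * i" for i
    using degree_power_le[of t_poly i] by simp
  have "degree P \<le> 3 * n"
    unfolding P_def
  proof (rule degree_sum_le)
    fix j assume "j \<in> {..n}"
    then show "degree (smult (p j) (t_poly ^ (n - j))) \<le> 3 * n"
      using degt[of "n - j"] degree_smult_le[of "p j" "t_poly ^ (n - j)"] by simp
  qed simp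
  moreover have "degree Q \<le> 3 * n"
    unfolding Q_def
  proof (rule degree_sum_le)
    fix i assume i: "i \<in> {..<n}"
    have "degree (g_poly x) \<le> 3"
      by (intro order_trans[OF degree_mult_le]) simp
    then have "degree (g_poly x * t_poly ^ i) \<le> 3 + 3 * i"
      using degree_mult_le[of "g_poly x" "t_poly ^ i"] degt[of i] by linarith
    then show "degree (smult (q i) (g_poly x * t_poly ^ i)) \<le> 3 * n"
      using i degree_smult_le[of "q i" "g_poly x * t_poly ^ i"] by simp
  qed simp
  ultimately have "degree (P - Q) \<le> 3 * n" by (rule degree_diff_le)
  then have "degree N \<le> n"
    unfolding N by (cases "N = 0") (simp_all add: degree_mult_eq degree_monom_eq)
  moreover have "coeff (monom 1 (2 * n) * N) (2 * n) = coeff N 0"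
    by (simp add: coeff_monom_mult)
  then have "poly N 0 = (\<Sum>j\<le>n. poly (a_poly (n + j)) x * p j)"
    using top by (simp add: N poly_0_coeff_0)
  moreover have "poly N 1 = p n"
  proof -
    have "poly P 1 = (\<Sum>j\<le>n. if j = n then p j else 0)"
      unfolding P_def poly_sum by (intro sum.cong) (auto simp: poly_power)
    moreover have "poly (g_poly x) 1 = 0" by simp
    then have "poly Q 1 = 0"
      unfolding Q_def poly_sum poly_smult poly_mult[of "g_poly x"] by (simp only: mult_zero_left mult_zero_right sum.neutral_const)
    ultimately have "poly (P - Q) 1 = p n" by simp
    then show ?thesis by (simp add: N poly_monom)
  qed
  ultimately show ?thesis using that[of q N] N by (simp add: P_def Q_def)
qed

section \<open>The Hankel determinant as a hypergeometric polynomial\<close>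

text \<open>The cofactors of the last row of the Hankel matrix \<open>[a\<^sub>i\<^sub>+\<^sub>j(x)]\<close> of size \<open>k + 2\<close>.\<close>
lemma hankel_cofactors:
  obtains p where
    "\<And>i. i < Suc k \<Longrightarrow> (\<Sum>j\<le>Suc k. poly (a_poly (i + j)) x * p j) = 0"
    "(\<Sum>j\<le>Suc k. poly (a_poly (Suc k + j)) x * p j) = poly (H_poly (Suc k)) x"
    "p (Suc k) = poly (H_poly k) x"
proof -
  define A where "A m = mat m m (\<lambda>(i, j). poly (a_poly (i + j)) x)" for m
  have A: "A m \<in> carrier_mat m m" for m by (simp add: A_def)
  interpret ev: comm_ring_hom "\<lambda>p. poly p x" by unfold_locales auto
  have det: "poly (H_poly n) x = det (A (n + 1))" for n
  proof -
    have "A (n + 1) = map_mat (\<lambda>p. poly p x) (mat (n + 1) (n + 1) (\<lambda>(i, j). a_poly (i + j)))"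
      by (auto simp: A_def)
    then show ?thesis by (simp add: H_poly_def)
  qed
  define p where "p j = cofactor (A (k + 2)) (k + 1) j" for j
  have sum: "(\<Sum>j\<le>Suc k. poly (a_poly (i + j)) x * p j) = (if i = Suc k then det (A (k + 2)) else 0)"
    if "i \<le> Suc k" for i
  proof -
    have "(A (k + 2) * adj_mat (A (k + 2))) $$ (i, k + 1) = (\<Sum>j<k + 2. poly (a_poly (i + j)) x * p j)"
      using that A[of "k + 2"]
      by (auto simp: times_mat_def scalar_prod_def adj_mat_def A_def p_def atLeast0LessThan intro!: sum.cong)
    also have "{..<k + 2} = {..Suc k}" by auto
    finally show ?thesis using that unfolding adj_mat(2)[OF A[of "k + 2"]] by (auto simp del: sum.atMost_Suc)
  qed
  have "mat_delete (A (k + 2)) (k + 1) (k + 1) = A (k + 1)"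
    by (rule eq_matI) (auto simp: mat_delete_def A_def)
  then have "p (Suc k) = poly (H_poly k) x"
    by (simp add: p_def cofactor_def det flip: power2_eq_square mult_2)
  moreover have "det (A (k + 2)) = poly (H_poly (Suc k)) x" by (simp add: det)
  ultimately show ?thesis using that[of p] sum[of "Suc k"] sum by simp
qed

text \<open>
  The remainder \<open>z\<^sup>2\<^sup>n N(z)\<close>, times \<open>(2x-2) - (2x-3) z\<close>, under the substitution
  \<open>z = -(1 - y)\<^sup>2 / (3y)\<close>; the factor \<open>3 y\<^sup>3\<^sup>n\<^sup>+\<^sup>1 (1 - y\<^sup>2)\<close> clears the denominators and completes the image of \<open>g\<close>. Under this substitution \<open>y\<^sup>3 t\<close> becomes \<open>-(1 - y\<^sup>3)\<^sup>2 / 27\<close>, a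
  polynomial in \<open>y\<^sup>3\<close>.
\<close>
definition hankel_lift :: "real \<Rightarrow> nat \<Rightarrow> (nat \<Rightarrow> real) \<Rightarrow> (nat \<Rightarrow> real) \<Rightarrow> real poly" where
  "hankel_lift x n p q =
     (\<Sum>j\<le>n. smult (p j) ([:0, 0, 0, 1:] ^ j * (smult (- 1 / 27) ([:1, 0, 0, -1:]\<^sup>2)) ^ (n - j))) *
       ([:1, 0, -1:] * [:2 * x - 3, 2 * x, 2 * x - 3:]) -
     smult (1 / 9) ((\<Sum>i<n. smult (q i) ([:0, 0, 0, 1:] ^ (n - 1 - i) * (smult (- 1 / 27) ([:1, 0, 0, -1:]\<^sup>2)) ^ i)) *
       ([:1, 0, 0, -1:] * ([:1, 0, 0, 1:] * ([:x, 3 - 2 * x, x:] * [:2 * x - 3, 2 * x, 2 * x - 3:]))))"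

lemma exps_hankel_lift: "exps_mod3_in {0, 1} (hankel_lift x n p q)"
proof -
  have 1: "exps_mod3_in {0} [:0, 0, 0, 1 :: real:]" by (rule exps_mod3_in_cubic)
  have 2: "exps_mod3_in {0} (smult (- 1 / 27) ([:1, 0, 0, -1 :: real:]\<^sup>2))"
    by (intro exps_mod3_in_smult exps_mod3_in_power exps_mod3_in_cubic)
  \<comment> \<open>the factor \<open>(2x-2) - (2x-3) z\<close> is chosen so that the \<open>y\<^sup>2\<close>-terms of both products vanish\<close>
  have 3: "[:1, 0, -1:] * [:2 * x - 3, 2 * x, 2 * x - 3:] =
     [:2 * x - 3, 2 * x, 0, - 2 * x, - (2 * x - 3):]" by simp
  have 4: "[:x, 3 - 2 * x, x:] * [:2 * x - 3, 2 * x, 2 * x - 3:] =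
     [:x * (2 * x - 3), 2 * x * x + (3 - 2 * x) * (2 * x - 3), 0,
       2 * x * x + (3 - 2 * x) * (2 * x - 3), x * (2 * x - 3):]"
    by (simp add: algebra_simps)
  show ?thesis
    unfolding hankel_lift_def 3 4
    by (intro exps_mod3_in_diff exps_mod3_in_smult exps_mod3_in_mult exps_mod3_in_sum
        exps_mod3_in_power exps_mod3_in_cubic exps_mod3_in_quartic 1 2)
qed

lemma poly_hankel_lift:
  fixes y :: real
  assumes y: "y \<noteq> 0"
  defines "z \<equiv> - (1 - y)\<^sup>2 / (3 * y)"
  assumes N: "(\<Sum>j\<le>n. smult (p j) (t_poly ^ (n - j))) - (\<Sum>i<n. smult (q i) (g_poly x * t_poly ^ i))
     = monom 1 (2 * n) * N"
  shows "9 ^ n / 3 * poly (hankel_lift x n p q) y =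
    (1 + y) * (1 - y) ^ (4 * n + 1) * y ^ (n + 1) * poly ([:2 * x - 2, - (2 * x - 3):] * N) z"
proof -
  define L \<kappa> where "L = poly [:2 * x - 3, 2 * x, 2 * x - 3:] y" and "\<kappa> = - (1 / 27) * (1 - y ^ 3)\<^sup>2"
  have L: "3 * y * poly [:2 * x - 2, - (2 * x - 3):] z = L"
    using y by (simp add: L_def z_def power2_eq_square field_simps)
  have t: "y ^ 3 * poly t_poly z = \<kappa>"
  proof -
    have "poly t_poly z = z * (1 - z)\<^sup>2" by (simp add: power2_eq_square algebra_simps)
    also have "1 - z = (1 + y + y\<^sup>2) / (3 * y)"
      using y by (simp add: z_def power2_eq_square field_simps)
    also have "y ^ 3 * (z * ((1 + y + y\<^sup>2) / (3 * y))\<^sup>2) = - (1 / 27) * ((1 - y) * (1 + y + y\<^sup>2))\<^sup>2"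
      using y by (simp add: z_def power2_eq_square power3_eq_cube)
    also have "(1 - y) * (1 + y + y\<^sup>2) = 1 - y ^ 3"
      by (simp add: power2_eq_square power3_eq_cube algebra_simps)
    finally show ?thesis by (simp add: \<kappa>_def)
  qed
  have g: "9 * (1 - y\<^sup>2) * (y ^ 3 * poly (g_poly x) z) =
     (1 - y ^ 3) * ((1 + y ^ 3) * poly [:x, 3 - 2 * x, x:] y)"
  proof -
    have "y * (1 - z) * 3 = 1 + y + y\<^sup>2" "y * (1 - 3 * z) = 1 - y + y\<^sup>2"
      "y * (1 - x * z) * 3 = poly [:x, 3 - 2 * x, x:] y"
      using y by (simp_all add: z_def power2_eq_square field_simps)
    moreover have "9 * (1 - y\<^sup>2) * (y ^ 3 * poly (g_poly x) z) =
       (1 - y\<^sup>2) * ((y * (1 - z) * 3) * (y * (1 - 3 * z)) * (y * (1 - x * z) * 3))"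
      unfolding poly_mult by (simp add: power3_eq_cube algebra_simps)
    moreover have "(1 - y\<^sup>2) * ((1 + y + y\<^sup>2) * (1 - y + y\<^sup>2)) = (1 - y ^ 3) * (1 + y ^ 3)"
      by (simp add: power2_eq_square power3_eq_cube algebra_simps)
    ultimately show ?thesis by (simp only: mult.assoc[symmetric])
  qed
  have eval: "poly (smult (- 1 / 27) ([:1, 0, 0, -1:]\<^sup>2)) y = \<kappa>" "poly [:0, 0, 0, 1:] y = y ^ 3"
     "poly [:1, 0, 0, -1:] y = 1 - y ^ 3" "poly [:1, 0, 0, 1:] y = 1 + y ^ 3" "poly [:1, 0, -1:] y = 1 - y\<^sup>2"
    unfolding poly_smult poly_power by (simp_all add: \<kappa>_def power2_eq_square power3_eq_cube mult.assoc)
  have A: "(\<Sum>j\<le>n. p j * ((y ^ 3) ^ j * \<kappa> ^ (n - j))) = y ^ (3 * n) * (\<Sum>j\<le>n. p j * poly t_poly z ^ (n - j))"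
    unfolding sum_distrib_left
  proof (rule sum.cong)
    fix j assume "j \<in> {..n}"
    then have "3 * n = 3 * j + 3 * (n - j)" by simp
    then have "y ^ (3 * n) = (y ^ 3) ^ j * (y ^ 3) ^ (n - j)" by (metis power_add power_mult)
    then show "p j * ((y ^ 3) ^ j * \<kappa> ^ (n - j)) = y ^ (3 * n) * (p j * poly t_poly z ^ (n - j))"
      unfolding t[symmetric] by (simp only: power_mult_distrib mult_ac)
  qed simp
  have B: "(\<Sum>i<n. q i * ((y ^ 3) ^ (n - 1 - i) * \<kappa> ^ i)) * y ^ 3 = y ^ (3 * n) * (\<Sum>i<n. q i * poly t_poly z ^ i)"
    unfolding sum_distrib_left sum_distrib_right
  proof (rule sum.cong)
    fix i assume i: "i \<in> {..<n}"
    then have "3 * n = 3 * (n - 1 - i) + 3 * i + 3" by auto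
    then have "y ^ (3 * n) = (y ^ 3) ^ (n - 1 - i) * (y ^ 3) ^ i * y ^ 3"
      by (metis power_add power_mult)
    then show "q i * ((y ^ 3) ^ (n - 1 - i) * \<kappa> ^ i) * y ^ 3 = y ^ (3 * n) * (q i * poly t_poly z ^ i)"
      unfolding t[symmetric] by (simp only: power_mult_distrib mult_ac)
  qed simp
  have Nz: "(\<Sum>j\<le>n. p j * poly t_poly z ^ (n - j)) - poly (g_poly x) z * (\<Sum>i<n. q i * poly t_poly z ^ i) =
     z ^ (2 * n) * poly N z"
    using arg_cong[OF N, of "\<lambda>f. poly f z"]
    unfolding poly_diff poly_sum poly_smult poly_mult poly_power poly_monom sum_distrib_left
    by (simp only: mult_1_left mult_ac)
  have "poly (hankel_lift x n p q) y =
     (\<Sum>j\<le>n. p j * ((y ^ 3) ^ j * \<kappa> ^ (n - j))) * ((1 - y\<^sup>2) * L) -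
     1 / 9 * ((\<Sum>i<n. q i * ((y ^ 3) ^ (n - 1 - i) * \<kappa> ^ i)) * ((1 - y ^ 3) * ((1 + y ^ 3) * (poly [:x, 3 - 2 * x, x:] y * L))))"
    unfolding hankel_lift_def poly_diff poly_mult poly_smult[of "1 / 9"] poly_sum poly_smult[of "p _"] poly_smult[of "q _"] poly_power
      eval L_def[symmetric] by (simp add: \<kappa>_def power2_eq_square power3_eq_cube)
  also have "(1 - y ^ 3) * ((1 + y ^ 3) * (poly [:x, 3 - 2 * x, x:] y * L)) =
     9 * (1 - y\<^sup>2) * (y ^ 3 * poly (g_poly x) z) * L"
    unfolding g by (simp only: mult.assoc)
  finally have "poly (hankel_lift x n p q) y = (1 - y\<^sup>2) * L *
     ((\<Sum>j\<le>n. p j * ((y ^ 3) ^ j * \<kappa> ^ (n - j))) -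
      poly (g_poly x) z * ((\<Sum>i<n. q i * ((y ^ 3) ^ (n - 1 - i) * \<kappa> ^ i)) * y ^ 3))"
    by (simp only: right_diff_distrib) (simp add: mult_ac)
  also have "\<dots> = (1 - y\<^sup>2) * L * (y ^ (3 * n) * (z ^ (2 * n) * poly N z))"
    unfolding A B Nz[symmetric] by (simp only: right_diff_distrib mult_ac)
  also have "y ^ (3 * n) * (z ^ (2 * n) * poly N z) = y ^ n * ((y * z) ^ (2 * n)) * poly N z"
  proof -
    have "3 * n = n + 2 * n" by simp
    then have "y ^ (3 * n) = y ^ n * y ^ (2 * n)" by (metis power_add)
    then show ?thesis by (simp add: power_mult_distrib)
  qed
  also have "(y * z) ^ (2 * n) = ((1 - y) ^ 4 / 9) ^ n"
  proof -
    have "(y * z)\<^sup>2 = (1 - y) ^ 4 / 9"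
      using y by (simp add: z_def field_simps power2_eq_square eval_nat_numeral)
    then show ?thesis by (simp only: power_mult)
  qed
  also have "((1 - y) ^ 4 / 9) ^ n = (1 - y) ^ (4 * n) / 9 ^ n"
    by (simp add: power_divide power_mult)
  also have "1 - y\<^sup>2 = (1 + y) * (1 - y)" by (simp add: power2_eq_square algebra_simps)
  finally have "9 ^ n / 3 * poly (hankel_lift x n p q) y =
     9 ^ n / 3 * ((1 + y) * (1 - y) * L * (y ^ n * ((1 - y) ^ (4 * n) / 9 ^ n) * poly N z))"
    by simp
  then show ?thesis unfolding L[symmetric] poly_mult by (simp add: mult_ac)
qed

lemma inj_on_substitution: "inj_on (\<lambda>y :: real. - (1 - y)\<^sup>2 / (3 * y)) {1<..}"
proof (rule inj_onI)
  fix a b :: real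
  assume ab: "a \<in> {1<..}" "b \<in> {1<..}" and eq: "- (1 - a)\<^sup>2 / (3 * a) = - (1 - b)\<^sup>2 / (3 * b)"
  then have "(a - b) * (a * b - 1) = 0"
    by (simp add: field_simps power2_eq_square)
  moreover have "a * b > 1" using ab by (simp add: less_1_mult)
  ultimately show "a = b" by simp
qed

text \<open>
  Both \<open>[(2x-2) - (2x-3) z] N(z)\<close> and a suitable combination of the corresponding polynomials for \<open>A\<^sub>k\<close> and
  \<open>A\<^sub>k\<^sub>+\<^sub>1\<close> have the same values at \<open>z = 0\<close> and \<open>z = 1\<close>. Their difference \<open>M\<close> vanishes by the uniqueness
  statement, and the relation is read off at the zero of \<open>(2x-2) - (2x-3) z\<close>.
\<close>
lemma hankel_A_relation:
  assumes x: "x \<noteq> 1" "2 * x \<noteq> 3"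
  shows "A_coeff (Suc k) (Suc k) * (- 1 / 4) ^ Suc k * (poly (H_poly (Suc k)) x * poly (A_poly k) ((x - 1) / 2)) =
         poly (H_poly k) x * poly (A_poly (Suc k)) ((x - 1) / 2)"
proof -
  define n where "n = Suc k"
  define h e where "h = poly (H_poly n) x" and "e = poly (H_poly k) x"
  obtain p where p: "\<And>i. i < n \<Longrightarrow> (\<Sum>j\<le>n. poly (a_poly (i + j)) x * p j) = 0"
    "(\<Sum>j\<le>n. poly (a_poly (n + j)) x * p j) = h" "p n = e"
    by (rule hankel_cofactors[of k x, folded n_def, folded h_def e_def]) (rule that)
  obtain q N where
    N: "(\<Sum>j\<le>n. smult (p j) (t_poly ^ (n - j))) - (\<Sum>i<n. smult (q i) (g_poly x * t_poly ^ i)) = monom 1 (2 * n) * N"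
      "degree N \<le> n"
    and N0: "poly N 0 = (\<Sum>j\<le>n. poly (a_poly (n + j)) x * p j)" and N1: "poly N 1 = p n"
    by (rule hankel_kernel_remainder[OF _ p(1)]) (simp add: n_def, assumption, rule that)
  have N01: "poly N 0 = h" "poly N 1 = e" using N0 N1 p(2,3) by (simp_all add: n_def)

  \<comment> \<open>\<open>E m = (1 - z)\<^sup>m A\<^sub>m(z / (4 (z - 1)))\<close>; its argument is the \<open>r\<close> of \<open>A_lift\<close> for \<open>z = -(1 - y)\<^sup>2 / (3y)\<close>\<close>
  define E where "E m = homogenize m (A_poly m) [:0, -1/4:] [:1, -1:]" for m
  have E: "poly (E m) z = (1 - z) ^ m * poly (A_poly m) (- z / (4 * (1 - z)))" if "z \<noteq> 1" for m z
    using that poly_homogenize[of "A_poly m" m "[:1, -1:]" z "[:0, -1/4:]"]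
    by (simp add: E_def degree_A_poly)
  have degE: "degree (E m) \<le> m" for m
    unfolding E_def homogenize_def
  proof (rule degree_sum_le)
    fix j assume "j \<in> {..m}"
    have "degree ([:0, -1/4:] ^ j * [:1, -1 :: real:] ^ (m - j)) \<le> degree ([:0, -1/4 :: real:] ^ j) + degree ([:1, -1 :: real:] ^ (m - j))"
      by (rule degree_mult_le)
    also have "\<dots> \<le> j + (m - j)"
      using degree_power_le[of "[:0, -1/4 :: real:]" j] degree_power_le[of "[:1, -1 :: real:]" "m - j"]
      by (intro add_mono) auto
    finally show "degree (smult (coeff (A_poly m) j) ([:0, -1/4:] ^ j * [:1, -1:] ^ (m - j))) \<le> m"
      using \<open>j \<in> {..m}\<close> degree_smult_le order_trans by fastforce
  qed simp
  define \<epsilon> where "\<epsilon> = A_coeff n n * (- 1 / 4) ^ n"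
  have \<epsilon>: "\<epsilon> \<noteq> 0" using A_coeff_top_sign[of n] by (auto simp: \<epsilon>_def)
  have E0: "poly (E m) 0 = 1" for m
    using E[of 0 m] by (simp add: poly_0_coeff_0)
  have E1: "poly (E n) 1 = \<epsilon>"
  proof -
    have "poly (E n) 1 = (\<Sum>j\<le>n. if j = n then A_coeff n j * (- 1 / 4) ^ j else 0)"
      unfolding E_def homogenize_def poly_sum by (intro sum.cong) auto
    then show ?thesis by (simp add: \<epsilon>_def)
  qed

  define M where "M = [:2 * x - 2, - (2 * x - 3):] * N - smult ((2 * x - 2) * h) ([:1, -1:]\<^sup>2 * E k) -
     smult (e / \<epsilon>) ([:0, 1:] * E n)"
  have degM: "degree M \<le> Suc n"
  proof -
    have "degree ([:2 * x - 2, - (2 * x - 3):] * N) \<le> Suc n"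
      using degree_mult_le[of "[:2 * x - 2, - (2 * x - 3):]" N] N(2) x by auto
    moreover have "degree (smult ((2 * x - 2) * h) ([:1, -1:]\<^sup>2 * E k)) \<le> Suc n"
      using degree_mult_le[of "[:1, -1:]\<^sup>2" "E k"] degE[of k] degree_power_le[of "[:1, -1 :: real:]" 2] 
        degree_smult_le[of "(2 * x - 2) * h" "[:1, -1:]\<^sup>2 * E k"]
      unfolding n_def degree_pCons_eq_if by auto
    moreover have "degree (smult (e / \<epsilon>) ([:0, 1:] * E n)) \<le> Suc n"
      using degree_mult_le[of "[:0, 1:]" "E n"] degE[of n] degree_smult_le[of "e / \<epsilon>" "[:0, 1:] * E n"] by simp
    ultimately show ?thesis unfolding M_def by (intro degree_diff_le)
  qed
  have "poly M 0 = 0" unfolding M_def by (simp add: N01 E0)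
  moreover have "poly M 1 = 0" using \<epsilon> unfolding M_def by (simp add: N01 E1 flip: distrib_right)
  ultimately obtain G where G: "M = [:0, 1:] * ([:1, -1:] * G)"
  proof -
    assume M0: "poly M 0 = 0" and M1: "poly M 1 = 0" and thesis: "\<And>G. M = [:0, 1:] * ([:1, -1:] * G) \<Longrightarrow> thesis"
    obtain G1 where G1: "M = [:0, 1:] * G1" using M0 by (auto simp: poly_eq_0_iff_dvd elim: dvdE)
    then have "poly G1 1 = 0" using M1 by simp
    then obtain G2 where "G1 = [:-1, 1:] * G2" by (auto simp: poly_eq_0_iff_dvd elim: dvdE)
    then have "M = [:0, 1:] * ([:1, -1:] * (- G2))" using G1 by simp
    then show thesis using thesis by blast
  qed
  have degG: "degree G \<le> k"
  proof (cases "G = 0")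
    case False
    have "[:1, -1 :: real:] \<noteq> 0" "[:0, 1 :: real:] \<noteq> 0" by simp_all
    then have "degree M = degree [:0, 1 :: real:] + (degree [:1, -1 :: real:] + degree G)"
      unfolding G using False by (simp only: degree_mult_eq mult_eq_0_iff simp_thms)
    then show ?thesis using degM by (simp add: n_def)
  qed simp

  \<comment> \<open>\<open>\<Delta>\<close> is \<open>M\<close> after the substitution; the zeros of \<open>M\<close> at 0 and 1 turn into additional factors\<close>
  define \<Delta> where "\<Delta> = smult (9 ^ n / 3) (hankel_lift x n p q)
    - smult ((2 * x - 2) * h / (9 * 12 ^ k)) ([:1, 0, 0, -1:]\<^sup>2 * A_lift k)
    + smult (e / \<epsilon> / (3 * 12 ^ n)) (A_lift n)"
  define K where "K = smult (- (1 / (9 * 3 ^ k))) ([:1, 1:] * homogenize k G [:-1, 2, -1:] [:0, 3:])"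
  have \<Delta>_M: "poly \<Delta> y = (1 + y) * (1 - y) ^ (4 * n + 1) * y ^ (n + 1) * poly M (- (1 - y)\<^sup>2 / (3 * y))"
    if y: "y \<noteq> 0" for y
  proof -
    define z where "z = - (1 - y)\<^sup>2 / (3 * y)"
    have b: "poly den_poly y > 0" by (rule poly_den_pos)
    have 1: "y * (1 - z) = poly den_poly y / 12"
      using y by (simp add: z_def power2_eq_square field_simps)
    then have z1: "z \<noteq> 1" using b by auto
    have r: "- z / (4 * (1 - z)) = poly num_poly y / poly den_poly y"
    proof -
      have "- z / (4 * (1 - z)) = (y * - z) / (4 * (y * (1 - z)))" using y by simp
      also have "y * - z = poly num_poly y / 3" using y by (simp add: z_def power2_eq_square field_simps)
      finally show ?thesis unfolding 1 by (simp del: poly_pCons)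
    qed
    have A_lift: "(1 + y) * (1 - y) ^ (4 * m + 3) * (y ^ m * poly (E m) z) = poly (A_lift m) y / 12 ^ m" for m
    proof -
      have "y ^ m * poly (E m) z = (y * (1 - z)) ^ m * poly (A_poly m) (poly num_poly y / poly den_poly y)"
        unfolding E[OF z1] r by (simp add: power_mult_distrib)
      also have "\<dots> = poly (homogenize m (A_poly m) num_poly den_poly) y / 12 ^ m"
        unfolding 1 power_divide using b degree_A_poly
        by (subst poly_homogenize) (auto simp del: poly_pCons)
      finally show ?thesis by (simp add: A_lift_def distrib_right)
    qed
    have yz: "y * z = - (1 - y)\<^sup>2 / 3" using y by (simp add: z_def)
    have T2: "(1 + y) * (1 - y) ^ (4 * n + 1) * y ^ (n + 1) * (z * poly (E n) z) = - (poly (A_lift n) y / (3 * 12 ^ n))"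
    proof -
      have "(1 + y) * (1 - y) ^ (4 * n + 1) * y ^ (n + 1) * (z * poly (E n) z) =
        (1 + y) * (1 - y) ^ (4 * n + 1) * (y * z) * (y ^ n * poly (E n) z)" by (simp add: mult_ac)
      also have "\<dots> = - (1 / 3) * ((1 + y) * (1 - y) ^ (4 * n + 3) * (y ^ n * poly (E n) z))"
        unfolding yz by (simp add: power2_eq_square eval_nat_numeral)
      finally show ?thesis unfolding A_lift by simp
    qed
    have T1: "(1 + y) * (1 - y) ^ (4 * n + 1) * y ^ (n + 1) * ((1 - z)\<^sup>2 * poly (E k) z) =
      (1 - y ^ 3)\<^sup>2 * poly (A_lift k) y / (9 * 12 ^ k)"
    proof -
      have c: "(1 - y) * (y * (1 - z)) = (1 - y ^ 3) / 3"
        unfolding 1 by (simp add: power3_eq_cube field_simps)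
      have "4 * n + 1 = 4 * k + 3 + 2" by (simp add: n_def)
      then have "(1 - y) ^ (4 * n + 1) = (1 - y) ^ (4 * k + 3) * (1 - y)\<^sup>2" by (metis power_add)
      moreover have "y ^ (n + 1) = y ^ k * y\<^sup>2" by (simp add: n_def power2_eq_square)
      ultimately have "(1 + y) * (1 - y) ^ (4 * n + 1) * y ^ (n + 1) * ((1 - z)\<^sup>2 * poly (E k) z) =
        ((1 - y) * (y * (1 - z)))\<^sup>2 * ((1 + y) * (1 - y) ^ (4 * k + 3) * (y ^ k * poly (E k) z))"
        by (simp only: power_mult_distrib mult_ac)
      then show ?thesis unfolding A_lift c by (simp add: power_divide)
    qed
    have "poly M z = poly ([:2 * x - 2, - (2 * x - 3):] * N) z - (2 * x - 2) * h * ((1 - z)\<^sup>2 * poly (E k) z)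
       - e / \<epsilon> * (z * poly (E n) z)"
      unfolding M_def poly_diff poly_smult by simp
    then have "(1 + y) * (1 - y) ^ (4 * n + 1) * y ^ (n + 1) * poly M z =
      (1 + y) * (1 - y) ^ (4 * n + 1) * y ^ (n + 1) * poly ([:2 * x - 2, - (2 * x - 3):] * N) z
      - (2 * x - 2) * h * ((1 + y) * (1 - y) ^ (4 * n + 1) * y ^ (n + 1) * ((1 - z)\<^sup>2 * poly (E k) z))
      - e / \<epsilon> * ((1 + y) * (1 - y) ^ (4 * n + 1) * y ^ (n + 1) * (z * poly (E n) z))"
      by (simp only: right_diff_distrib mult_ac)
    also have "\<dots> = 9 ^ n / 3 * poly (hankel_lift x n p q) y
       - (2 * x - 2) * h * ((1 - y ^ 3)\<^sup>2 * poly (A_lift k) y / (9 * 12 ^ k))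
       - e / \<epsilon> * (- (poly (A_lift n) y / (3 * 12 ^ n)))"
      unfolding T1 T2 poly_hankel_lift[OF y N(1), folded z_def] ..
    also have "\<dots> = poly \<Delta> y"
    proof -
      have "poly [:1, 0, 0, -1:] y = 1 - y ^ 3" by (simp add: power3_eq_cube)
      then show ?thesis unfolding \<Delta>_def poly_add poly_diff poly_smult poly_mult poly_power by simp
    qed
    finally show ?thesis by (simp add: z_def)
  qed

  have \<Delta>_eq: "\<Delta> = [:1, -1:] ^ (4 * n + 3) * [:1, 1, 1:] * K"
  proof (rule poly_eqI_cofinite)
    fix y :: real assume "y \<notin> {0}"
    then have y: "y \<noteq> 0" by simp
    define z where "z = - (1 - y)\<^sup>2 / (3 * y)"
    have yz: "y * z = - (1 - y)\<^sup>2 / 3" "y * (1 - z) = (1 + y + y\<^sup>2) / 3"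
      using y by (simp_all add: z_def power2_eq_square field_simps)
    have hom: "poly (homogenize k G [:-1, 2, -1:] [:0, 3:]) y = 3 ^ k * (y ^ k * poly G z)"
    proof -
      have "poly [:-1, 2, -1:] y / poly [:0, 3:] y = z"
        by (simp add: z_def power2_eq_square algebra_simps)
      then show ?thesis using poly_homogenize[OF degG, of "[:0, 3:]" y] y by (simp add: power_mult_distrib)
    qed
    have "poly \<Delta> y = (1 + y) * (1 - y) ^ (4 * n + 1) * y ^ (n + 1) * (z * ((1 - z) * poly G z))"
      unfolding \<Delta>_M[OF y] G z_def[symmetric] poly_mult by simp
    also have "\<dots> = (1 + y) * (1 - y) ^ (4 * n + 1) * (y * z) * (y * (1 - z)) * (y ^ k * poly G z)"
      by (simp add: n_def mult_ac)
    also have "\<dots> = - (1 / 9) * ((1 + y) * (1 - y) ^ (4 * n + 3) * (1 + y + y\<^sup>2) * (y ^ k * poly G z))"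
      unfolding yz by (simp add: power2_eq_square eval_nat_numeral)
    also have "\<dots> = poly ([:1, -1:] ^ (4 * n + 3) * [:1, 1, 1:] * K) y"
      unfolding K_def poly_mult poly_smult hom poly_power by (simp add: power2_eq_square field_simps)
    finally show "poly \<Delta> y = poly ([:1, -1:] ^ (4 * n + 3) * [:1, 1, 1:] * K) y" .
  qed simp
  have deg\<Delta>: "degree \<Delta> \<le> 6 * n + 4"
  proof -
    have "degree K \<le> 1 + 2 * k"
      unfolding K_def
      using degree_smult_le[of "- (1 / (9 * 3 ^ k))" "[:1, 1:] * homogenize k G [:-1, 2, -1:] [:0, 3:]"]
        degree_mult_le[of "[:1, 1:]" "homogenize k G [:-1, 2, -1:] [:0, 3:]"]
        degree_homogenize_le[of "[:-1, 2, -1:]" "[:0, 3:]" k G] by simp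
    moreover have "degree ([:1, -1 :: real:] ^ (4 * n + 3)) \<le> 4 * n + 3"
      using degree_power_le[of "[:1, -1 :: real:]" "4 * n + 3"] by simp
    moreover have "degree (D * [:1, 1, 1:] * K) \<le> degree D + 2 + degree K" for D :: "real poly"
      using degree_mult_le[of "D * [:1, 1, 1:]" K] degree_mult_le[of D "[:1, 1, 1:]"] by simp
    ultimately have "degree ([:1, -1:] ^ (4 * n + 3) * [:1, 1, 1:] * K) \<le> (4 * n + 3) + 2 + (1 + 2 * k)"
      by (meson add_mono order_refl order_trans)
    also have "(4 * n + 3) + 2 + (1 + 2 * k) = 6 * n + 4" by (simp add: n_def)
    finally show ?thesis unfolding \<Delta>_eq .
  qed
  have "exps_mod3_in {0, 1} \<Delta>"
    unfolding \<Delta>_def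
    by (intro exps_mod3_in_diff exps_mod3_in_add exps_mod3_in_smult exps_mod3_in_mult exps_mod3_in_power
        exps_mod3_in_cubic exps_A_lift exps_hankel_lift)
  then have \<Delta>0: "\<Delta> = 0" using deg\<Delta> \<Delta>_eq by (rule exps_mod3_order_eq_0)

  have "M = 0"
  proof (rule ccontr)
    assume "M \<noteq> 0"
    then have "finite {z. poly M z = 0}" by (rule poly_roots_finite)
    moreover have "(\<lambda>y. - (1 - y)\<^sup>2 / (3 * y)) ` {1<..} \<subseteq> {z. poly M z = 0}"
    proof (rule image_subsetI)
      fix y :: real assume "y \<in> {1<..}"
      then show "- (1 - y)\<^sup>2 / (3 * y) \<in> {z. poly M z = 0}" using \<Delta>_M[of y] \<Delta>0 by simp
    qed
    ultimately have "finite ((\<lambda>y :: real. - (1 - y)\<^sup>2 / (3 * y)) ` {1<..})"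
      by (rule finite_subset[rotated])
    then show False
      using finite_image_iff[OF inj_on_substitution] infinite_Ioi by blast
  qed

  \<comment> \<open>the zero of \<open>(2x-2) - (2x-3) z\<close>, where the argument of \<open>A\<^sub>k\<close> becomes \<open>(x - 1) / 2\<close>\<close>
  define z where "z = (2 * x - 2) / (2 * x - 3)"
  have z: "1 - z = - 1 / (2 * x - 3)" "z \<noteq> 1" "- z / (4 * (1 - z)) = (x - 1) / 2"
    "(2 * x - 2) * (1 - z) = - z" "z \<noteq> 0"
    using x by (simp_all add: z_def field_simps)
  have "0 = poly M z" using \<open>M = 0\<close> by simp
  also have "\<dots> = (2 * x - 2 - z * (2 * x - 3)) * poly N z - (2 * x - 2) * h * ((1 - z)\<^sup>2 * poly (E k) z) - e / \<epsilon> * (z * poly (E n) z)"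
    unfolding M_def poly_diff poly_smult by (simp add: algebra_simps)
  also have "2 * x - 2 - z * (2 * x - 3) = 0" using x by (simp add: z_def)
  also have "(2 * x - 2) * h * ((1 - z)\<^sup>2 * poly (E k) z) =
     ((2 * x - 2) * (1 - z)) * h * ((1 - z) ^ n * poly (A_poly k) ((x - 1) / 2))"
    unfolding E[OF z(2)] z(3) by (simp add: n_def power2_eq_square)
  also have "\<dots> = - z * h * ((1 - z) ^ n * poly (A_poly k) ((x - 1) / 2))"
    unfolding z(4) ..
  also have "poly (E n) z = (1 - z) ^ n * poly (A_poly n) ((x - 1) / 2)"
    unfolding E[OF z(2)] z(3) ..
  finally have "z * (1 - z) ^ n * (h * poly (A_poly k) ((x - 1) / 2) - e / \<epsilon> * poly (A_poly n) ((x - 1) / 2)) = 0"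
    by (simp add: algebra_simps)
  then have "h * poly (A_poly k) ((x - 1) / 2) = e / \<epsilon> * poly (A_poly n) ((x - 1) / 2)"
    using z(2,5) by simp
  then show ?thesis using \<epsilon> by (simp add: h_def e_def n_def \<epsilon>_def field_simps)
qed

lemma H_poly_eq_A_poly:
  "\<exists>c. c \<noteq> 0 \<and> H_poly n = smult c (A_poly n \<circ>\<^sub>p [:-1/2, 1/2:])"
proof (induction n)
  case 0
  have "H_poly 0 = 1"
    by (simp add: H_poly_def det_single a_poly_def monom_0)
  moreover have "A_poly 0 = 1"
    by (simp add: A_poly_def hyp_poly_def monom_0)
  ultimately show ?case by (intro exI[of _ 1]) (simp add: pcompose_1)
next
  case (Suc k)
  let ?A = "\<lambda>n. A_poly n \<circ>\<^sub>p [:-1/2, 1/2 :: real:]"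
  obtain c where c: "c \<noteq> 0" "H_poly k = smult c (?A k)" using Suc by auto
  define \<epsilon> where "\<epsilon> = A_coeff (Suc k) (Suc k) * (- 1 / 4) ^ Suc k"
  have \<epsilon>: "\<epsilon> \<noteq> 0" using A_coeff_top_sign[of "Suc k"] by (auto simp: \<epsilon>_def)
  have "smult \<epsilon> (H_poly (Suc k) * ?A k) = H_poly k * ?A (Suc k)"
  proof (rule poly_eqI_cofinite)
    fix x :: real assume "x \<notin> {1, 3 / 2}"
    then have "x \<noteq> 1" "2 * x \<noteq> 3" by auto
    moreover have "poly [:-1/2, 1/2:] x = (x - 1) / 2" by (simp add: field_simps)
    ultimately show "poly (smult \<epsilon> (H_poly (Suc k) * ?A k)) x = poly (H_poly k * ?A (Suc k)) x"
      using hankel_A_relation[of x k] unfolding poly_smult poly_mult poly_pcompose \<epsilon>_def by metis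
  qed simp
  then have eq: "?A k * smult \<epsilon> (H_poly (Suc k)) = ?A k * smult c (?A (Suc k))"
    unfolding c(2) by (simp add: mult.commute)
  have "?A k \<noteq> 0" using A_coeff_top_sign[of k] by (auto simp: pcompose_eq_0_iff)
  then have H: "smult \<epsilon> (H_poly (Suc k)) = smult c (?A (Suc k))"
    using eq by (rule mult_left_cancel[THEN iffD1])
  have "H_poly (Suc k) = smult (inverse \<epsilon>) (smult \<epsilon> (H_poly (Suc k)))" using \<epsilon> by simp
  also have "\<dots> = smult (inverse \<epsilon> * c) (?A (Suc k))" unfolding H by (rule smult_smult)
  finally show ?case using c(1) \<epsilon> by (intro exI[of _ "inverse \<epsilon> * c"]) simp
qed

section \<open>Interlacing of the roots\<close>

theorem corollary5:
  fixes n :: nat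
  assumes "n > 0"
  shows "all_roots_real (H_poly n) \<and> roots_interlace n (H_poly n) (H_poly (n + 1))"
proof -
  obtain r where r: "increasing_roots (A_poly n) n r" using A_poly_roots by blast
  obtain s where s: "increasing_roots (A_poly (Suc n)) (Suc n) s"
    and rs: "\<And>i. i < n \<Longrightarrow> s i < r i \<and> r i < s (Suc i)"
    using A_poly_Suc_roots[OF r] by blast
  obtain c d where c: "c \<noteq> 0" "H_poly n = smult c (A_poly n \<circ>\<^sub>p [:-1/2, 1/2:])"
    and d: "d \<noteq> 0" "H_poly (n + 1) = smult d (A_poly (Suc n) \<circ>\<^sub>p [:-1/2, 1/2:])"
    using H_poly_eq_A_poly[of n] H_poly_eq_A_poly[of "n + 1"] by auto
  have nz: "A_poly m \<noteq> 0" for m using A_coeff_top_sign[of m] by auto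
  note R = increasing_roots_rescaled[OF r degree_A_poly nz c]
  note S = increasing_roots_rescaled[OF s degree_A_poly nz d]
  have "roots_interlace n (H_poly n) (H_poly (n + 1))"
    unfolding roots_interlace_def
    by (intro conjI exI[of _ "map (\<lambda>i. 2 * r i + 1) [0..<n]"] exI[of _ "map (\<lambda>i. 2 * s i + 1) [0..<Suc n]"] R S)
       (use rs in \<open>auto simp del: upt_Suc\<close>)
  then show ?thesis using R(4) by blast
qed

end
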